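(* Let $\varphi\colon\mathbb{T}^+\times X\to X$ be a dynamical system on a compact metric space $X$. Let $\mathsf{M}$ be a finite poset of nonempty, pairwise disjoint, compact, invariant sets in $X$. Then $\mathsf{M}$ is a Morse representation subordinate to a finite sublattice $\mathsf{A}(\mathsf{M})\subset\mathsf{Att}(\varphi)$ if and only if for every $x\in X$ there exists $M\in\mathsf{M}$ such that $\omega(x)\subset M$, and for each complete orbit $\gamma_x$ with $x\notin\bigcup_{M\in\mathsf{M}}M$ there exist $M<M'$ in $\mathsf{M}$ such that $\omega(x)\subset M$ and $\alpha_{\rm o}(\gamma_x^-)\subset M'$. The associated lattice $\mathsf{A}(\mathsf{M})$ is the image of the injective lattice homomorphism $\nu\colon\mathsf{O}(\mathsf{M})\to\mathsf{Invset}(\varphi)$ given by $$\alpha\mapsto\nu(\alpha)=\bigcup_{M\in\alpha}W^u(M)\in\mathsf{Att}(\varphi),$$ and $\mathsf{M}=\mathsf{M}\bigl(\mathsf{A}(\mathsf{M})\bigr)$.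
   Context: $\mathbb{T}$ is $\mathbb{Z}$ or $\mathbb{R}$, $\mathbb{T}^{+}=\{t\in\mathbb T\mid t\ge0\}$, $\mathbb{T}^-=\{t\in\mathbb T\mid t\le 0\}$. A dynamical system is a continuous map $\varphi\colon\mathbb{T}^+\times X\to X$ with $\varphi(0,x)=x$ and $\varphi(t,\varphi(s,x))=\varphi(t+s,x)$ (not necessarily invertible). For $U\subset X$, $\omega(U)=\bigcap_{t\ge0}\mathrm{cl}\bigcup_{s\ge t}\varphi(s,U)$, and $\omega(x)=\omega(\{x\})$. A complete orbit through $x$ is a map $\gamma_x\colon\mathbb{T}\to X$ with $\gamma_x(0)=x$ and $\gamma_x(t+s)=\varphi(s,\gamma_x(t))$ for all $t\in\mathbb T$, $s\ge0$. A backward orbit $\gamma_x^-\colon\mathbb{T}^-\to X$ through $x$ satisfies $\gamma_x^-(0)=x$ and $\gamma_x^-(t+s)=\varphi(s,\gamma_x^-(t))$ for $s\ge0$, $t+s\le0$; for a complete orbit $\gamma_x$, $\gamma_x^-$ is its restriction to $\mathbb{T}^-$. Put $\alpha_{\rm o}(\gamma_x^-)=\bigcap_{t\le0}\mathrm{cl}\{\gamma_x^-(s)\mid s\le t\}$. A set $S$ is invariant if $\varphi(t,S)=S$ for all $t\ge0$; $\mathsf{Invset}(\varphi)$ is the lattice of invariant sets with join $\cup$ and meet $S\wedge S'=\mathrm{Inv}(S\cap S')$, where $\mathrm{Inv}(U)$ is the maximal invariant subset of $U$. For a compact invariant set $S$, $W^u(S)=\{x\in X\mid\text{there is a backward orbit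 }\gamma_x^-\text{ through }x\text{ with }\alpha_{\rm o}(\gamma_x^-)\subset S\}$. $A\subset X$ is an attractor if there is an open neighborhood $U$ of $A$ with $\omega(U)=A$. The attractors form a bounded distributive lattice $\mathsf{Att}(\varphi)$ with $A\vee A'=A\cup A'$, $A\wedge A'=\omega(A\cap A')$, $0=\varnothing$, $1=\omega(X)$. The dual repeller of an attractor $A$ is $A^*=\{x\in X\mid\omega(x)\cap A=\varnothing\}$. Sublattices contain $0$ and $1$, and lattice homomorphisms between bounded lattices preserve them. For a finite sublattice $\mathsf{A}\subset\mathsf{Att}(\varphi)$, let $\mathsf{J}(\mathsf{A})$ be its set of join-irreducible elements (nonzero elements $A$ with a unique immediate predecessor $\overleftarrow{A}$ in $\mathsf{A}$). The Morse representation subordinate to $\mathsf{A}$ is the poset $\mathsf{M}(\mathsf{A})=\{A\cap\overleftarrow{A}^{\,*}\mid A\in\mathsf{J}(\mathsf{A})\}$ ordered by $A\cap\overleftarrow{A}^{\,*}\le A'\cap\overleftarrow{A'}^{\,*}$ iff $A\subset A'$. "$\mathsf{M}$ is a Morse representation subordinate to $\mathsf{A}$" means $\mathsf{M}=\mathsf{M}(\mathsf{A})$ as posets. $\mathsf{O}(\mathsf{M})$ is the lattice of down-sets of $\mathsf{M}$ under $\cup,\cap$. *)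

theory Defs
  imports "HOL-Analysis.Analysis"
begin

section \<open>Semiflows over discrete or continuous time\<close>

text \<open>
  Both time sets are treated as subsets \<open>T\<close> of the reals, with the subspace topology, so that
  \<open>\<int>\<close> is discrete. Semiflows and orbits are functions on \<^typ>\<open>real\<close> of which only the values at
  times in the relevant part of \<open>T\<close> matter. The phase space is a compact subset \<open>X\<close> of a metric
  space; \<open>X\<close> being closed, \<^const>\<open>closure\<close> of a subset of \<open>X\<close> is its closure in \<open>X\<close>.
\<close>

definition nonneg_times :: "real set \<Rightarrow> real set"
  where "nonneg_times T = {t \<in> T. 0 \<le> t}"

definition nonpos_times :: "real set \<Rightarrow> real set"
  where "nonpos_times T = {t \<in> T. t \<le> 0}"

locale compact_dynamical_system =
  fixes T :: "real set" and X :: "'a::metric_space set" and \<phi> :: "real \<Rightarrow> 'a \<Rightarrow> 'a"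
  assumes time: "T = \<int> \<or> T = UNIV"
    and compact_space: "compact X"
    and maps_to: "\<And>t x. t \<in> nonneg_times T \<Longrightarrow> x \<in> X \<Longrightarrow> \<phi> t x \<in> X"
    and continuous: "continuous_on (nonneg_times T \<times> X) (\<lambda>(t, x). \<phi> t x)"
    and at_zero: "\<And>x. x \<in> X \<Longrightarrow> \<phi> 0 x = x"
    and semigroup: "\<And>s t x. s \<in> nonneg_times T \<Longrightarrow> t \<in> nonneg_times T \<Longrightarrow> x \<in> X
      \<Longrightarrow> \<phi> t (\<phi> s x) = \<phi> (t + s) x"

definition omega_limit :: "real set \<Rightarrow> (real \<Rightarrow> 'a::metric_space \<Rightarrow> 'a) \<Rightarrow> 'a set \<Rightarrow> 'a set"
  where "omega_limit T \<phi> U =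
    (\<Inter>t\<in>nonneg_times T. closure (\<Union>s\<in>{s \<in> nonneg_times T. t \<le> s}. \<phi> s ` U))"

definition complete_orbit ::
    "real set \<Rightarrow> 'a set \<Rightarrow> (real \<Rightarrow> 'a \<Rightarrow> 'a) \<Rightarrow> 'a \<Rightarrow> (real \<Rightarrow> 'a) \<Rightarrow> bool"
  where "complete_orbit T X \<phi> x \<gamma> \<longleftrightarrow>
    (\<forall>t\<in>T. \<gamma> t \<in> X) \<and> \<gamma> 0 = x \<and> (\<forall>t\<in>T. \<forall>s\<in>nonneg_times T. \<gamma> (t + s) = \<phi> s (\<gamma> t))"

definition backward_orbit ::
    "real set \<Rightarrow> 'a set \<Rightarrow> (real \<Rightarrow> 'a \<Rightarrow> 'a) \<Rightarrow> 'a \<Rightarrow> (real \<Rightarrow> 'a) \<Rightarrow> bool"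
  where "backward_orbit T X \<phi> x \<gamma> \<longleftrightarrow>
    (\<forall>t\<in>nonpos_times T. \<gamma> t \<in> X) \<and> \<gamma> 0 = x \<and>
    (\<forall>t\<in>nonpos_times T. \<forall>s\<in>nonneg_times T. t + s \<le> 0 \<longrightarrow> \<gamma> (t + s) = \<phi> s (\<gamma> t))"

text \<open>
  The limit set depends only on the values of \<open>\<gamma>\<close> at nonpositive times, so for a complete orbit
  it is the limit set of the restriction to these times.
\<close>

definition alpha_limit :: "real set \<Rightarrow> (real \<Rightarrow> 'a::metric_space) \<Rightarrow> 'a set"
  where "alpha_limit T \<gamma> = (\<Inter>t\<in>nonpos_times T. closure {\<gamma> s |s. s \<in> nonpos_times T \<and> s \<le> t})"

definition invariant :: "real set \<Rightarrow> 'a set \<Rightarrow> (real \<Rightarrow> 'a \<Rightarrow> 'a) \<Rightarrow> 'a set \<Rightarrow> bool"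
  where "invariant T X \<phi> S \<longleftrightarrow> S \<subseteq> X \<and> (\<forall>t\<in>nonneg_times T. \<phi> t ` S = S)"

text \<open>The maximal invariant subset, as a union of invariant sets is invariant.\<close>

definition Inv :: "real set \<Rightarrow> 'a set \<Rightarrow> (real \<Rightarrow> 'a \<Rightarrow> 'a) \<Rightarrow> 'a set \<Rightarrow> 'a set"
  where "Inv T X \<phi> U = \<Union>{S. invariant T X \<phi> S \<and> S \<subseteq> U}"

definition unstable_set ::
    "real set \<Rightarrow> 'a set \<Rightarrow> (real \<Rightarrow> 'a::metric_space \<Rightarrow> 'a) \<Rightarrow> 'a set \<Rightarrow> 'a set"
  where "unstable_set T X \<phi> S =
    {x \<in> X. \<exists>\<gamma>. backward_orbit T X \<phi> x \<gamma> \<and> alpha_limit T \<gamma> \<subseteq> S}"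

definition attractor :: "real set \<Rightarrow> 'a set \<Rightarrow> (real \<Rightarrow> 'a::metric_space \<Rightarrow> 'a) \<Rightarrow> 'a set \<Rightarrow> bool"
  where "attractor T X \<phi> A \<longleftrightarrow>
    (\<exists>U. openin (top_of_set X) U \<and> A \<subseteq> U \<and> omega_limit T \<phi> U = A)"

definition dual_repeller ::
    "real set \<Rightarrow> 'a set \<Rightarrow> (real \<Rightarrow> 'a::metric_space \<Rightarrow> 'a) \<Rightarrow> 'a set \<Rightarrow> 'a set"
  where "dual_repeller T X \<phi> A = {x \<in> X. omega_limit T \<phi> {x} \<inter> A = {}}"


section \<open>Bounded lattices of sets\<close>

text \<open>
  All lattices below are ordered by inclusion, but their meets need not be intersections. The
  record holds the operations only; no lattice axioms are imposed.
\<close>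

record 'l bdd_lattice =
  elems :: "'l set"
  join :: "'l \<Rightarrow> 'l \<Rightarrow> 'l"
  meet :: "'l \<Rightarrow> 'l \<Rightarrow> 'l"
  lbot :: 'l
  ltop :: 'l

definition sublattice :: "'l set \<Rightarrow> 'l bdd_lattice \<Rightarrow> bool"
  where "sublattice K L \<longleftrightarrow> K \<subseteq> elems L \<and> lbot L \<in> K \<and> ltop L \<in> K \<and>
    (\<forall>a\<in>K. \<forall>b\<in>K. join L a b \<in> K \<and> meet L a b \<in> K)"

definition lattice_hom :: "'k bdd_lattice \<Rightarrow> 'l bdd_lattice \<Rightarrow> ('k \<Rightarrow> 'l) \<Rightarrow> bool"
  where "lattice_hom K L f \<longleftrightarrow>
    f ` elems K \<subseteq> elems L \<and> f (lbot K) = lbot L \<and> f (ltop K) = ltop L \<and>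
    (\<forall>a\<in>elems K. \<forall>b\<in>elems K. f (join K a b) = join L (f a) (f b) \<and>
       f (meet K a b) = meet L (f a) (f b))"

definition Invset :: "real set \<Rightarrow> 'a set \<Rightarrow> (real \<Rightarrow> 'a \<Rightarrow> 'a) \<Rightarrow> 'a set bdd_lattice"
  where "Invset T X \<phi> = \<lparr>elems = {S. invariant T X \<phi> S}, join = (\<union>),
    meet = (\<lambda>S S'. Inv T X \<phi> (S \<inter> S')), lbot = {}, ltop = Inv T X \<phi> X\<rparr>"

definition Att :: "real set \<Rightarrow> 'a set \<Rightarrow> (real \<Rightarrow> 'a::metric_space \<Rightarrow> 'a) \<Rightarrow> 'a set bdd_lattice"
  where "Att T X \<phi> = \<lparr>elems = {A. attractor T X \<phi> A}, join = (\<union>),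
    meet = (\<lambda>A A'. omega_limit T \<phi> (A \<inter> A')), lbot = {}, ltop = omega_limit T \<phi> X\<rparr>"


section \<open>Finite posets and Morse representations\<close>

text \<open>
  A poset is a pair \<open>(M, r)\<close> of a carrier and its reflexive order relation, so that equality of
  pairs is equality as posets.
\<close>

definition finite_poset :: "'b set \<times> 'b rel \<Rightarrow> bool"
  where "finite_poset = (\<lambda>(M, r). finite M \<and> partial_order_on M r)"

definition Downsets :: "'b set \<times> 'b rel \<Rightarrow> 'b set bdd_lattice"
  where "Downsets = (\<lambda>(M, r).
    \<lparr>elems = {\<alpha>. \<alpha> \<subseteq> M \<and> (\<forall>p\<in>\<alpha>. \<forall>q\<in>M. (q, p) \<in> r \<longrightarrow> q \<in> \<alpha>)},
     join = (\<union>), meet = (\<inter>), lbot = {}, ltop = M\<rparr>)"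

definition immediate_pred :: "'a set set \<Rightarrow> 'a set \<Rightarrow> 'a set \<Rightarrow> bool"
  where "immediate_pred \<A> B A \<longleftrightarrow> B \<in> \<A> \<and> B \<subset> A \<and> \<not> (\<exists>C\<in>\<A>. B \<subset> C \<and> C \<subset> A)"

definition join_irreducibles :: "'a set set \<Rightarrow> 'a set set"
  where "join_irreducibles \<A> = {A \<in> \<A>. A \<noteq> {} \<and> (\<exists>!B. immediate_pred \<A> B A)}"

definition the_pred :: "'a set set \<Rightarrow> 'a set \<Rightarrow> 'a set"
  where "the_pred \<A> A = (THE B. immediate_pred \<A> B A)"

definition morse_set ::
    "real set \<Rightarrow> 'a set \<Rightarrow> (real \<Rightarrow> 'a::metric_space \<Rightarrow> 'a) \<Rightarrow> 'a set set \<Rightarrow> 'a set \<Rightarrow> 'a set"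
  where "morse_set T X \<phi> \<A> A = A \<inter> dual_repeller T X \<phi> (the_pred \<A> A)"

definition morse_rep ::
    "real set \<Rightarrow> 'a set \<Rightarrow> (real \<Rightarrow> 'a::metric_space \<Rightarrow> 'a) \<Rightarrow>
     'a set set \<Rightarrow> 'a set set \<times> 'a set rel"
  where "morse_rep T X \<phi> \<A> =
    (morse_set T X \<phi> \<A> ` join_irreducibles \<A>,
     {(morse_set T X \<phi> \<A> A, morse_set T X \<phi> \<A> A') |A A'.
        A \<in> join_irreducibles \<A> \<and> A' \<in> join_irreducibles \<A> \<and> A \<subseteq> A'})"

definition morse_rep_subordinate_to ::
    "real set \<Rightarrow> 'a set \<Rightarrow> (real \<Rightarrow> 'a::metric_space \<Rightarrow> 'a) \<Rightarrow> 'a set set \<times> 'a set rel \<Rightarrow>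
     'a set set \<Rightarrow> bool"
  where "morse_rep_subordinate_to T X \<phi> P \<A> \<longleftrightarrow>
    finite \<A> \<and> sublattice \<A> (Att T X \<phi>) \<and> P = morse_rep T X \<phi> \<A>"

definition nu ::
    "real set \<Rightarrow> 'a set \<Rightarrow> (real \<Rightarrow> 'a::metric_space \<Rightarrow> 'a) \<Rightarrow> 'a set set \<Rightarrow> 'a set"
  where "nu T X \<phi> \<alpha> = (\<Union>M\<in>\<alpha>. unstable_set T X \<phi> M)"

end

(*
  A limit set S = omega(x) or S = alpha(gamma) lies inside or outside of every attractor. Hence in a
  finite lattice of attractors the smallest member C containing S is join-irreducible, and S lies in
  the Morse set of C. This gives the two conditions on limit sets, and it shows that an attractor of
  the lattice is the union of the unstable sets of the Morse sets it contains, so the lattice is the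
  image of nu.

  Conversely, assume the two conditions. If a Morse set meets nu(alpha) for a down-set alpha, it
  belongs to alpha. A closed invariant set K lies in nu(alpha) as soon as it meets no Morse set
  outside alpha, for the orbits in K come from Morse sets that meet K. To exclude that K meets such a
  Morse set, take a maximal one, M, and points of K near M that come from the vicinity of nu(alpha).
  The limit of the points where their backward orbits first leave a fixed neighborhood of M is a point
  of K outside all Morse sets with omega-limit set in M; its backward orbit in K comes from a Morse
  set larger than M, contrary to maximality. With K the closure of nu(alpha) this shows that nu(alpha)
  is closed, and with K = omega(U) for a small neighborhood U that it is an attractor. The
  join-irreducible elements of the image of nu are the images of the principal down-sets.
*)

theory Submission
  imports Defs
begin

section \<open>Limit sets\<close>

text \<open>As \<open>\<phi>\<close> need not be invertible, a point may have no backward orbit or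
  several, and even a point of a Morse set can have one that leaves the set. Invariance only
  supplies some complete orbit inside a set. Hence statements on where an orbit comes from concern
  individual orbits. The obstacle to closedness of \<open>\<nu>(\<alpha>)\<close> is that
  alpha-limit sets do not vary continuously: a limit of its points might come from elsewhere. Exit
  points avoid any continuity of limit sets. They are taken at integer times, which treats both time
  sets alike; the hypothesis that \<open>\<omega>(y)\<close> lies in a single Morse set bridges the
  gaps between the samples. In the attractor step \<open>K = \<omega>(U)\<close> is fixed, while the
  orbit segments have to start ever closer to \<open>\<nu>(\<alpha>)\<close>. Two facts reconcile
  this: for \<open>U\<close> small enough, a Morse set outside \<open>\<alpha>\<close> that meets
  \<open>\<omega>(U)\<close> also does so for all smaller neighborhoods, and segments starting close
  to \<open>\<nu>(\<alpha>)\<close> need long times to get away from it, so that limits of exit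
  points lie in \<open>\<omega>(U)\<close>.\<close>

definition tail_limit :: "real set \<Rightarrow> (real \<Rightarrow> 'a::metric_space set) \<Rightarrow> 'a set"
  where "tail_limit T G = (\<Inter>t\<in>nonneg_times T. closure (\<Union>s\<in>{s \<in> nonneg_times T. t \<le> s}. G s))"

text \<open>With \<open>alpha_limit_eq_tail_limit\<close>, this lets nonemptiness, attraction and
  invariance be proved once for both kinds of limit set.\<close>

lemma omega_limit_eq_tail_limit: "omega_limit T \<phi> U = tail_limit T (\<lambda>s. \<phi> s ` U)"
  by (simp add: omega_limit_def tail_limit_def)

lemma closed_tail_limit: "closed (tail_limit T G)"
  unfolding tail_limit_def by (intro closed_INT ballI closed_closure)

text \<open>Membership is asked only eventually because a shift into the past makes finitely many of
  the times negative.\<close>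

lemma tail_limitI:
  assumes "filterlim s at_top sequentially"
    and "\<forall>\<^sub>F n in sequentially. s n \<in> nonneg_times T \<and> z n \<in> G (s n)"
    and "z \<longlonglongrightarrow> y"
  shows "y \<in> tail_limit T G"
  unfolding tail_limit_def
proof
  fix t assume "t \<in> nonneg_times T"
  have "\<forall>\<^sub>F n in sequentially. t \<le> s n"
    using assms(1) by (simp add: filterlim_at_top)
  with assms(2) have "\<forall>\<^sub>F n in sequentially.
      z n \<in> closure (\<Union>s\<in>{s \<in> nonneg_times T. t \<le> s}. G s)"
  proof eventually_elim
    case (elim n)
    then have "z n \<in> (\<Union>s\<in>{s \<in> nonneg_times T. t \<le> s}. G s)" by blast
    then show ?case by (rule subsetD[OF closure_subset])
  qed
  then show "y \<in> closure (\<Union>s\<in>{s \<in> nonneg_times T. t \<le> s}. G s)"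
    using Lim_in_closed_set[OF closed_closure _ sequentially_bot assms(3)] by blast
qed

lemma filterlim_real_lower_bound:
  fixes s :: "nat \<Rightarrow> real"
  assumes "\<And>n. real n \<le> s n"
  shows "filterlim s at_top sequentially"
  by (rule filterlim_at_top_mono[OF filterlim_real_sequentially]) (simp add: assms)

lemma LIMSEQ_of_dist_bound:
  fixes z :: "nat \<Rightarrow> 'a::metric_space"
  assumes "\<And>n. dist (z n) y < inverse (real (Suc n))"
  shows "z \<longlonglongrightarrow> y"
proof -
  have "(\<lambda>n. dist (z n) y) \<longlonglongrightarrow> 0"
  proof (rule Lim_null_comparison[OF _ LIMSEQ_inverse_real_of_nat])
    show "\<forall>\<^sub>F n in sequentially. norm (dist (z n) y) \<le> inverse (real (Suc n))"
      using less_imp_le[OF assms] by (intro always_eventually allI) simp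
  qed
  then show ?thesis by (rule iffD2[OF tendsto_dist_iff])
qed

context compact_dynamical_system
begin

lemma zero_time [simp]: "0 \<in> T" and one_time [simp]: "1 \<in> T"
  and nat_time [simp]: "real n \<in> T"
  and add_time: "s \<in> T \<Longrightarrow> t \<in> T \<Longrightarrow> s + t \<in> T"
  and diff_time: "s \<in> T \<Longrightarrow> t \<in> T \<Longrightarrow> s - t \<in> T"
  and minus_time: "t \<in> T \<Longrightarrow> - t \<in> T"
  using time by auto

lemma closed_time: "closed T"
  using time by (auto simp: closed_Ints)

lemma nat_nonneg_time [simp]: "real n \<in> nonneg_times T" "0 \<in> nonneg_times T" "1 \<in> nonneg_times T"
  by (auto simp: nonneg_times_def)

lemma add_nonneg_time: "s \<in> nonneg_times T \<Longrightarrow> t \<in> nonneg_times T \<Longrightarrow> s + t \<in> nonneg_times T"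
  by (auto simp: nonneg_times_def add_time)

lemma flow_tendsto:
  assumes "u \<longlonglongrightarrow> x" "x \<in> X" "\<And>n. u n \<in> X" "\<tau> \<longlonglongrightarrow> t" "t \<in> nonneg_times T"
    "\<And>n. \<tau> n \<in> nonneg_times T"
  shows "(\<lambda>n. \<phi> (\<tau> n) (u n)) \<longlonglongrightarrow> \<phi> t x"
proof -
  have "(\<lambda>n. (\<lambda>(t, x). \<phi> t x) (\<tau> n, u n)) \<longlonglongrightarrow> (\<lambda>(t, x). \<phi> t x) (t, x)"
    by (rule continuous_on_tendsto_compose[OF continuous])
      (use assms in \<open>auto intro!: tendsto_Pair\<close>)
  then show ?thesis by simp
qed

lemma flow_tendsto_const:
  assumes "u \<longlonglongrightarrow> x" "x \<in> X" "\<And>n. u n \<in> X" "t \<in> nonneg_times T"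
  shows "(\<lambda>n. \<phi> t (u n)) \<longlonglongrightarrow> \<phi> t x"
  using flow_tendsto[of u x "\<lambda>_. t" t] assms by simp

lemma closed_X: "closed X"
  using compact_space by (rule compact_imp_closed)

lemma convergent_subseq:
  assumes "\<And>n. z n \<in> X"
  obtains y k where "y \<in> X" "strict_mono (k :: nat \<Rightarrow> nat)" "(\<lambda>n. z (k n)) \<longlonglongrightarrow> y"
  using compact_space[unfolded compact_def] assms unfolding o_def by blast

lemma tail_limit_subset:
  assumes "\<And>s. s \<in> nonneg_times T \<Longrightarrow> G s \<subseteq> C" "closed C"
  shows "tail_limit T G \<subseteq> C"
proof -
  have "tail_limit T G \<subseteq> closure (\<Union>s\<in>{s \<in> nonneg_times T. 0 \<le> s}. G s)"
    unfolding tail_limit_def by (rule INF_lower) simp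
  also have "\<dots> \<subseteq> C" using assms by (intro closure_minimal) auto
  finally show ?thesis .
qed

lemma tail_limitE:
  assumes "y \<in> tail_limit T G"
  obtains s z where "\<And>n. s n \<in> nonneg_times T" "\<And>n. real n \<le> s n" "\<And>n. z n \<in> G (s n)" "z \<longlonglongrightarrow> y"
proof -
  let ?Q = "\<lambda>n s z. s \<in> nonneg_times T \<and> real n \<le> s \<and> z \<in> G s \<and> dist z y < inverse (real (Suc n))"
  have "\<exists>s z. ?Q n s z" for n
  proof -
    have "y \<in> closure (\<Union>s\<in>{s \<in> nonneg_times T. real n \<le> s}. G s)"
      using assms[unfolded tail_limit_def] nat_nonneg_time(1) by (rule INT_D)
    from this[unfolded closure_approachable, rule_format, of "inverse (real (Suc n))"]
    show ?thesis by auto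
  qed
  then have "\<forall>n. \<exists>p. ?Q n (fst p) (snd p)" by simp
  then have "\<exists>p. \<forall>n. ?Q n (fst (p n)) (snd (p n))" by (rule choice)
  then obtain p where p: "\<forall>n. ?Q n (fst (p n)) (snd (p n))" ..
  show thesis
    by (rule that[of "\<lambda>n. fst (p n)" "\<lambda>n. snd (p n)"]) (use p in \<open>auto intro: LIMSEQ_of_dist_bound\<close>)
qed

lemma tail_limit_convergent_subseq:
  assumes "\<And>s. s \<in> nonneg_times T \<Longrightarrow> G s \<subseteq> X"
    and "\<And>n. s n \<in> nonneg_times T" "\<And>n. real n \<le> s n" "\<And>n. z n \<in> G (s n)"
  obtains y k where "y \<in> tail_limit T G" "strict_mono k" "(\<lambda>n. z (k n)) \<longlonglongrightarrow> y"
proof -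
  have "z n \<in> X" for n using assms by blast
  then obtain y k where k: "strict_mono k" "(\<lambda>n. z (k n)) \<longlonglongrightarrow> y"
    using convergent_subseq[of z] by blast
  have "filterlim (\<lambda>n. s (k n)) at_top sequentially"
    using filterlim_compose[OF filterlim_real_lower_bound[of s] filterlim_subseq[OF k(1)]] assms by simp
  then have "y \<in> tail_limit T G"
    by (rule tail_limitI) (use assms k in auto)
  with k that show ?thesis by blast
qed

lemma tail_limit_nonempty:
  assumes "\<And>s. s \<in> nonneg_times T \<Longrightarrow> G s \<subseteq> X" "\<And>s. s \<in> nonneg_times T \<Longrightarrow> G s \<noteq> {}"
  shows "tail_limit T G \<noteq> {}"
proof -
  have "\<forall>n. \<exists>z. z \<in> G (real n)" using assms(2) by (auto simp: ex_in_conv)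
  then obtain z where "\<And>n. z n \<in> G (real n)" by metis
  with tail_limit_convergent_subseq[of G real z] assms(1) show ?thesis by auto
qed

text \<open>Otherwise points outside \<open>V\<close> at arbitrarily late times would accumulate at
  a point of the limit set outside \<open>V\<close>.\<close>

lemma tail_limit_attracts:
  assumes "\<And>s. s \<in> nonneg_times T \<Longrightarrow> G s \<subseteq> X" "tail_limit T G \<subseteq> V" "open V"
  obtains t where "t \<in> nonneg_times T" "\<And>s. s \<in> nonneg_times T \<Longrightarrow> t \<le> s \<Longrightarrow> G s \<subseteq> V"
proof (rule ccontr)
  assume *: "\<not> thesis"
  have "\<exists>s z. s \<in> nonneg_times T \<and> real n \<le> s \<and> z \<in> G s \<and> z \<notin> V" for n
    using * that[of "real n"] nat_nonneg_time(1)[of n] by blast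
  then obtain s z where sz: "\<And>n. s n \<in> nonneg_times T" "\<And>n. real n \<le> s n" "\<And>n. z n \<in> G (s n)"
      "\<And>n. z n \<notin> V"
    by metis
  obtain y k where y: "y \<in> tail_limit T G" "strict_mono k" "(\<lambda>n. z (k n)) \<longlonglongrightarrow> y"
    by (rule tail_limit_convergent_subseq[where G = G and s = s and z = z, OF assms(1) sz(1,2,3)])
  have "y \<in> - V"
    by (rule closed_sequentially[OF _ _ y(3)]) (use assms(3) sz(4) in \<open>auto simp: closed_Compl\<close>)
  with y(1) assms(2) show False by blast
qed

text \<open>The shift is \<open>c = t\<close> for forward images and \<open>c = - t\<close> along backward orbits.\<close>

lemma tail_limit_invariant:
  assumes X: "\<And>s. s \<in> nonneg_times T \<Longrightarrow> G s \<subseteq> X"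
    and shift: "\<And>t. t \<in> nonneg_times T \<Longrightarrow>
      \<exists>c\<in>{t, - t}. \<forall>s\<in>nonneg_times T. 0 \<le> s + c \<longrightarrow> \<phi> t ` G s = G (s + c)"
  shows "invariant T X \<phi> (tail_limit T G)"
proof -
  let ?L = "tail_limit T G"
  have LX: "?L \<subseteq> X" using tail_limit_subset[OF X closed_X] .
  have "\<phi> t ` ?L = ?L" if t: "t \<in> nonneg_times T" for t
  proof -
    obtain c where c: "c = t \<or> c = - t"
        and cG: "\<And>s. s \<in> nonneg_times T \<Longrightarrow> 0 \<le> s + c \<Longrightarrow> \<phi> t ` G s = G (s + c)"
      using shift[OF t] by blast
    have cT: "c \<in> T" using c t minus_time by (auto simp: nonneg_times_def)
    show ?thesis
    proof (intro equalityI subsetI)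
      fix w assume "w \<in> \<phi> t ` ?L"
      then obtain y where y: "y \<in> ?L" "w = \<phi> t y" by blast
      obtain s z where sz: "\<And>n. s n \<in> nonneg_times T" "\<And>n. real n \<le> s n" "\<And>n. z n \<in> G (s n)" "z \<longlonglongrightarrow> y"
        using tail_limitE[OF y(1)] by metis
      have zX: "z n \<in> X" for n using X[OF sz(1)] sz(3) by blast
      have lim: "(\<lambda>n. \<phi> t (z n)) \<longlonglongrightarrow> w"
        unfolding y(2) by (rule flow_tendsto_const) (use sz(4) zX LX y t in auto)
      have top: "filterlim (\<lambda>n. s n + c) at_top sequentially"
        using filterlim_tendsto_add_at_top[OF tendsto_const[of c] filterlim_real_lower_bound[of s]] sz(2)
        by (simp add: add.commute)
      then have "\<forall>\<^sub>F n in sequentially. 0 \<le> s n + c"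
        by (simp add: filterlim_at_top)
      then have "\<forall>\<^sub>F n in sequentially. s n + c \<in> nonneg_times T \<and> \<phi> t (z n) \<in> G (s n + c)"
      proof eventually_elim
        case (elim n)
        have "\<phi> t (z n) \<in> G (s n + c)"
          using cG[OF sz(1) elim] sz(3)[of n] by (metis imageI)
        moreover have "s n + c \<in> nonneg_times T"
          using elim sz(1)[of n] cT by (auto simp: nonneg_times_def add_time)
        ultimately show ?case by blast
      qed
      with top show "w \<in> ?L" using lim by (rule tail_limitI)
    next
      fix w assume "w \<in> ?L"
      then obtain s z where sz: "\<And>n. s n \<in> nonneg_times T" "\<And>n. real n \<le> s n" "\<And>n. z n \<in> G (s n)" "z \<longlonglongrightarrow> w"
        using tail_limitE by metis
      \<comment> \<open>Skipping the first \<open>m\<close> terms keeps \<open>s (n + m) - c\<close>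
        at least \<open>n\<close>, hence nonnegative, for either sign of \<open>c\<close>.\<close>
      define m where "m = nat \<lceil>\<bar>c\<bar>\<rceil>"
      have mc: "\<bar>c\<bar> \<le> real m" unfolding m_def by linarith
      \<comment> \<open>Surjectivity is obtained without an inverse: the preimages
        \<open>u n\<close> accumulate at a point of the limit set, which continuity sends to
        \<open>w\<close>.\<close>
      have "\<exists>u. u \<in> G (s (n + m) - c) \<and> \<phi> t u = z (n + m)" for n
      proof -
        have "s (n + m) - c \<in> nonneg_times T"
          using sz(1)[of "n + m"] sz(2)[of "n + m"] cT mc by (auto simp: nonneg_times_def diff_time)
        from cG[OF this] sz(1)[of "n + m"] have "\<phi> t ` G (s (n + m) - c) = G (s (n + m))"
          by (auto simp: nonneg_times_def)
        then show ?thesis using sz(3)[of "n + m"] by (metis imageE)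
      qed
      then obtain u where u: "\<And>n. u n \<in> G (s (n + m) - c)" "\<And>n. \<phi> t (u n) = z (n + m)"
        by metis
      have s': "s (n + m) - c \<in> nonneg_times T" "real n \<le> s (n + m) - c" for n
        using sz(1)[of "n + m"] sz(2)[of "n + m"] cT mc by (auto simp: nonneg_times_def diff_time)
      obtain y k where y: "y \<in> ?L" "strict_mono k" "(\<lambda>n. u (k n)) \<longlonglongrightarrow> y"
        by (rule tail_limit_convergent_subseq[where G = G and z = u and s = "\<lambda>n. s (n + m) - c", OF X s' u(1)])
      have uX: "u n \<in> X" for n using X[OF s'(1)] u(1) by blast
      have "(\<lambda>n. \<phi> t (u (k n))) \<longlonglongrightarrow> \<phi> t y"
        by (rule flow_tendsto_const) (use y LX uX t in auto)
      moreover have "(\<lambda>n. z (k n + m)) \<longlonglongrightarrow> w"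
        using LIMSEQ_subseq_LIMSEQ[OF LIMSEQ_ignore_initial_segment[OF sz(4), of m] y(2)]
        by (simp add: o_def)
      ultimately have "\<phi> t y = w" using u(2) LIMSEQ_unique by auto
      then show "w \<in> \<phi> t ` ?L" using y(1) by blast
    qed
  qed
  with LX show ?thesis by (auto simp: invariant_def)
qed

end

lemma alpha_limit_eq_tail_limit:
  assumes "\<And>t. t \<in> T \<Longrightarrow> - t \<in> T"
  shows "alpha_limit T \<gamma> = tail_limit T (\<lambda>s. {\<gamma> (- s)})"
proof -
  have times: "nonpos_times T = uminus ` nonneg_times T"
    using assms by (force simp: nonpos_times_def nonneg_times_def image_iff)
  have "{\<gamma> s |s. s \<in> nonpos_times T \<and> s \<le> - t} =
      (\<Union>s\<in>{s \<in> nonneg_times T. t \<le> s}. {\<gamma> (- s)})" for t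
    unfolding times by auto
  then show ?thesis
    unfolding alpha_limit_def tail_limit_def times by simp
qed

lemma omega_limit_mono: "U \<subseteq> V \<Longrightarrow> omega_limit T \<phi> U \<subseteq> omega_limit T \<phi> V"
  unfolding omega_limit_def by (intro INF_mono' closure_mono UN_mono image_mono) auto

context compact_dynamical_system
begin

lemma nonneg_time_in: "t \<in> nonneg_times T \<Longrightarrow> t \<in> T"
  by (simp add: nonneg_times_def)

lemma omega_limit_invariant:
  assumes "U \<subseteq> X"
  shows "invariant T X \<phi> (omega_limit T \<phi> U)"
  unfolding omega_limit_eq_tail_limit
proof (rule tail_limit_invariant)
  show "\<phi> s ` U \<subseteq> X" if "s \<in> nonneg_times T" for s
    using assms maps_to that by blast
  fix t assume t: "t \<in> nonneg_times T"
  have "\<phi> t ` \<phi> s ` U = \<phi> (s + t) ` U" if "s \<in> nonneg_times T" for s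
    unfolding image_image
    by (rule image_cong[OF refl]) (use assms semigroup[OF that t] in \<open>auto simp: add.commute\<close>)
  then show "\<exists>c\<in>{t, - t}. \<forall>s\<in>nonneg_times T. 0 \<le> s + c \<longrightarrow> \<phi> t ` \<phi> s ` U = \<phi> (s + c) ` U"
    by simp
qed

lemma invariant_subset_space: "invariant T X \<phi> S \<Longrightarrow> S \<subseteq> X"
  by (simp add: invariant_def)

lemma invariant_image: "invariant T X \<phi> S \<Longrightarrow> t \<in> nonneg_times T \<Longrightarrow> \<phi> t ` S = S"
  by (simp add: invariant_def)

lemma invariant_forward: "invariant T X \<phi> S \<Longrightarrow> t \<in> nonneg_times T \<Longrightarrow> x \<in> S \<Longrightarrow> \<phi> t x \<in> S"
  using invariant_image by blast

lemma compact_subspace: "closed S \<Longrightarrow> S \<subseteq> X \<Longrightarrow> compact S"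
  using compact_space by (metis closed_Int_compact inf.absorb1)

lemma closed_omega_limit: "closed (omega_limit T \<phi> U)"
  unfolding omega_limit_eq_tail_limit by (rule closed_tail_limit)

lemma omega_limit_nonempty:
  assumes "x \<in> X"
  shows "omega_limit T \<phi> {x} \<noteq> {}"
  unfolding omega_limit_eq_tail_limit
  by (rule tail_limit_nonempty) (use assms maps_to in auto)

lemma omega_limit_subset:
  assumes "closed K" "K \<subseteq> X" "\<And>t x. t \<in> nonneg_times T \<Longrightarrow> x \<in> K \<Longrightarrow> \<phi> t x \<in> K" "U \<subseteq> K"
  shows "omega_limit T \<phi> U \<subseteq> K"
  unfolding omega_limit_eq_tail_limit
  by (rule tail_limit_subset) (use assms in auto)

lemma omega_limit_point_subset:
  assumes "closed K" "invariant T X \<phi> K" "x \<in> K"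
  shows "omega_limit T \<phi> {x} \<subseteq> K"
  using omega_limit_subset[of K "{x}"] assms invariant_forward invariant_subset_space by simp

text \<open>\<open>S\<close> is its own image under every \<open>\<phi> t\<close>, so it is
  contained in every tail of the images of \<open>U\<close>.\<close>

lemma invariant_subset_omega_limit:
  assumes "invariant T X \<phi> S" "S \<subseteq> U"
  shows "S \<subseteq> omega_limit T \<phi> U"
  unfolding omega_limit_def
proof (rule INT_greatest)
  fix t assume t: "t \<in> nonneg_times T"
  have "S \<subseteq> (\<Union>s\<in>{s \<in> nonneg_times T. t \<le> s}. \<phi> s ` U)"
  proof
    fix y assume "y \<in> S"
    then have "y \<in> \<phi> t ` S" by (simp only: invariant_image[OF assms(1) t])
    then have "y \<in> \<phi> t ` U" using assms(2) by blast
    then show "y \<in> (\<Union>s\<in>{s \<in> nonneg_times T. t \<le> s}. \<phi> s ` U)" using t by blast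
  qed
  then show "S \<subseteq> closure (\<Union>s\<in>{s \<in> nonneg_times T. t \<le> s}. \<phi> s ` U)"
    using closure_subset by (rule subset_trans)
qed

text \<open>The tails of \<open>G\<close> decrease, so only those from time \<open>c\<close> on
  matter, and these are exactly the tails of \<open>G'\<close>.\<close>

lemma tail_limit_shift:
  assumes c: "c \<in> nonneg_times T" and G': "\<And>s. s \<in> nonneg_times T \<Longrightarrow> G' s = G (s + c)"
  shows "tail_limit T G' = tail_limit T G"
proof -
  let ?tail = "\<lambda>G t. \<Union>s\<in>{s \<in> nonneg_times T. t \<le> s}. G s"
  have eq: "?tail G (t + c) = ?tail G' t" if t: "t \<in> nonneg_times T" for t
  proof -
    have "(\<lambda>s. s + c) ` {s \<in> nonneg_times T. t \<le> s} = {s \<in> nonneg_times T. t + c \<le> s}"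
    proof (intro equalityI subsetI)
      fix s assume "s \<in> {s \<in> nonneg_times T. t + c \<le> s}"
      then have "s - c \<in> {s \<in> nonneg_times T. t \<le> s}"
        using c t by (auto simp: nonneg_times_def diff_time)
      then show "s \<in> (\<lambda>s. s + c) ` {s \<in> nonneg_times T. t \<le> s}"
        by (rule rev_image_eqI) simp
    qed (use c add_nonneg_time in auto)
    then have "?tail G (t + c) = (\<Union>s\<in>(\<lambda>s. s + c) ` {s \<in> nonneg_times T. t \<le> s}. G s)"
      by simp
    also have "\<dots> = ?tail G' t" by (simp add: G')
    finally show ?thesis .
  qed
  have "?tail G (t + c) \<subseteq> ?tail G t" for t
    using c by (intro UN_mono) (auto simp: nonneg_times_def)
  then have sub: "closure (?tail G' t) \<subseteq> closure (?tail G t)" if "t \<in> nonneg_times T" for t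
    unfolding eq[OF that, symmetric] by (rule closure_mono)
  show ?thesis
    unfolding tail_limit_def
  proof (rule equalityI)
    show "(\<Inter>t\<in>nonneg_times T. closure (?tail G' t)) \<subseteq> (\<Inter>t\<in>nonneg_times T. closure (?tail G t))"
      by (rule INT_anti_mono[OF subset_refl sub])
    show "(\<Inter>t\<in>nonneg_times T. closure (?tail G t)) \<subseteq> (\<Inter>t\<in>nonneg_times T. closure (?tail G' t))"
    proof (rule INT_greatest)
      fix t assume t: "t \<in> nonneg_times T"
      show "(\<Inter>t\<in>nonneg_times T. closure (?tail G t)) \<subseteq> closure (?tail G' t)"
        unfolding eq[OF t, symmetric] by (rule INF_lower[OF add_nonneg_time[OF t c]])
    qed
  qed
qed

lemma omega_limit_flow:
  assumes "U \<subseteq> X" "t \<in> nonneg_times T"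
  shows "omega_limit T \<phi> (\<phi> t ` U) = omega_limit T \<phi> U"
  unfolding omega_limit_eq_tail_limit
proof (rule tail_limit_shift[OF assms(2)])
  fix s assume "s \<in> nonneg_times T"
  then show "\<phi> s ` \<phi> t ` U = \<phi> (s + t) ` U"
    using assms semigroup[OF assms(2)] by (auto simp: image_image intro!: image_cong)
qed

section \<open>Complete orbits and unstable sets\<close>

lemma alpha_limit_tail: "alpha_limit T \<gamma> = tail_limit T (\<lambda>s. {\<gamma> (- s)})"
  by (rule alpha_limit_eq_tail_limit) (rule minus_time)

lemma complete_orbit_in_space: "complete_orbit T X \<phi> x \<gamma> \<Longrightarrow> t \<in> T \<Longrightarrow> \<gamma> t \<in> X"
  by (simp add: complete_orbit_def)

lemma complete_orbit_zero: "complete_orbit T X \<phi> x \<gamma> \<Longrightarrow> \<gamma> 0 = x"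
  by (simp add: complete_orbit_def)

lemma complete_orbit_flow:
  "complete_orbit T X \<phi> x \<gamma> \<Longrightarrow> t \<in> T \<Longrightarrow> s \<in> nonneg_times T \<Longrightarrow> \<gamma> (t + s) = \<phi> s (\<gamma> t)"
  by (simp add: complete_orbit_def)

lemma complete_orbit_flow_diff:
  assumes "complete_orbit T X \<phi> x \<gamma>" "s \<in> T" "t \<in> T" "s \<le> t"
  shows "\<gamma> t = \<phi> (t - s) (\<gamma> s)"
  using complete_orbit_flow[OF assms(1,2), of "t - s"] assms(2-4)
  by (simp add: nonneg_times_def diff_time)

lemma complete_orbit_shift:
  assumes "complete_orbit T X \<phi> x \<gamma>" "u \<in> T"
  shows "complete_orbit T X \<phi> (\<gamma> u) (\<lambda>t. \<gamma> (t + u))"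
  unfolding complete_orbit_def
proof (intro conjI ballI)
  fix t s assume "t \<in> T" "s \<in> nonneg_times T"
  then show "\<gamma> (t + s + u) = \<phi> s (\<gamma> (t + u))"
    using complete_orbit_flow[OF assms(1) add_time[OF \<open>t \<in> T\<close> assms(2)]]
    by (simp add: algebra_simps)
qed (use assms in \<open>auto intro: complete_orbit_in_space add_time\<close>)

lemma alpha_limit_shift:
  assumes "u \<in> T"
  shows "alpha_limit T (\<lambda>t. \<gamma> (t + u)) = alpha_limit T \<gamma>"
\<comment> \<open>\<open>tail_limit_shift\<close> moves to later times only, so the sign of
  \<open>u\<close> decides which of the two orbits counts as the shifted one.\<close>
proof (cases "0 \<le> u")
  case True
  show ?thesis
    unfolding alpha_limit_tail
    by (rule tail_limit_shift[symmetric, of u]) (use assms True in \<open>auto simp: nonneg_times_def\<close>)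
next
  case False
  show ?thesis
    unfolding alpha_limit_tail
    by (rule tail_limit_shift[of "- u"]) (use assms False in \<open>auto simp: nonneg_times_def minus_time\<close>)
qed

lemma alpha_limit_nonempty:
  assumes "complete_orbit T X \<phi> x \<gamma>"
  shows "alpha_limit T \<gamma> \<noteq> {}"
  unfolding alpha_limit_tail
  by (rule tail_limit_nonempty)
    (use assms in \<open>auto intro: complete_orbit_in_space minus_time nonneg_time_in\<close>)

lemma alpha_limit_subset:
  assumes "\<And>t. t \<in> T \<Longrightarrow> \<gamma> t \<in> C" "closed C"
  shows "alpha_limit T \<gamma> \<subseteq> C"
  unfolding alpha_limit_tail
  by (rule tail_limit_subset) (use assms in \<open>auto intro: minus_time nonneg_time_in\<close>)

lemma closed_alpha_limit: "closed (alpha_limit T \<gamma>)"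
  unfolding alpha_limit_tail by (rule closed_tail_limit)

lemma alpha_limit_invariant:
  assumes \<gamma>: "complete_orbit T X \<phi> x \<gamma>"
  shows "invariant T X \<phi> (alpha_limit T \<gamma>)"
  unfolding alpha_limit_tail
proof (rule tail_limit_invariant)
  show "{\<gamma> (- s)} \<subseteq> X" if "s \<in> nonneg_times T" for s
    using complete_orbit_in_space[OF \<gamma>] that by (simp add: minus_time nonneg_time_in)
  fix t assume t: "t \<in> nonneg_times T"
  have "\<phi> t ` {\<gamma> (- s)} = {\<gamma> (- (s + - t))}" if "s \<in> nonneg_times T" for s
    using complete_orbit_flow[OF \<gamma> _ t, of "- s"] that
    by (simp add: minus_time nonneg_time_in)
  then show "\<exists>c\<in>{t, - t}. \<forall>s\<in>nonneg_times T. 0 \<le> s + c \<longrightarrow> \<phi> t ` {\<gamma> (- s)} = {\<gamma> (- (s + c))}"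
    by blast
qed

text \<open>The unstable set is defined by backward orbits, the connecting condition by complete
  ones. The forward orbit of \<open>x\<close> fills the positive times, which the alpha-limit set
  does not see.\<close>

lemma backward_orbit_extends:
  assumes "backward_orbit T X \<phi> x \<gamma>"
  obtains \<eta> where "complete_orbit T X \<phi> x \<eta>" "alpha_limit T \<eta> = alpha_limit T \<gamma>"
proof
  define \<eta> where "\<eta> t = (if t \<le> 0 then \<gamma> t else \<phi> t x)" for t
  have \<gamma>X: "\<And>t. t \<in> nonpos_times T \<Longrightarrow> \<gamma> t \<in> X" and \<gamma>0: "\<gamma> 0 = x"
    and \<gamma>flow: "\<And>t s. t \<in> nonpos_times T \<Longrightarrow> s \<in> nonneg_times T \<Longrightarrow> t + s \<le> 0 \<Longrightarrow>
      \<gamma> (t + s) = \<phi> s (\<gamma> t)"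
    using assms unfolding backward_orbit_def by auto
  have x: "x \<in> X" using \<gamma>X[of 0] \<gamma>0 by (simp add: nonpos_times_def)
  show "complete_orbit T X \<phi> x \<eta>"
    unfolding complete_orbit_def
  proof (intro conjI ballI)
    fix t assume "t \<in> T"
    then show "\<eta> t \<in> X"
      using \<gamma>X[of t] maps_to[OF _ x, of t] by (auto simp: \<eta>_def nonpos_times_def nonneg_times_def)
  next
    fix t s assume t: "t \<in> T" and s: "s \<in> nonneg_times T"
    show "\<eta> (t + s) = \<phi> s (\<eta> t)"
    proof (cases "t \<le> 0")
      case False
      then show ?thesis
        using semigroup[OF _ s x, of t] s t by (auto simp: \<eta>_def nonneg_times_def add.commute)
    next
      case True
      then have t': "t \<in> nonpos_times T" "- t \<in> nonneg_times T"
        using t by (auto simp: nonpos_times_def nonneg_times_def minus_time)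
      show ?thesis
      proof (cases "t + s \<le> 0")
        case True
        then show ?thesis using \<open>t \<le> 0\<close> \<gamma>flow[OF t'(1) s] by (simp add: \<eta>_def)
      next
        case False
        then have ts: "t + s \<in> nonneg_times T"
          using t s by (auto simp: nonneg_times_def add_time)
        \<comment> \<open>Expressing \<open>x\<close> through \<open>\<gamma> t\<close> reduces the
          passage across time 0 to the semigroup law.\<close>
        have "\<phi> (t + s) x = \<phi> (t + s) (\<phi> (- t) (\<gamma> t))"
          using \<gamma>flow[OF t'] \<gamma>0 by simp
        also have "\<dots> = \<phi> s (\<gamma> t)"
          using semigroup[OF t'(2) ts \<gamma>X[OF t'(1)]] by simp
        finally show ?thesis using False \<open>t \<le> 0\<close> by (simp add: \<eta>_def)
      qed
    qed
  qed (simp add: \<eta>_def \<gamma>0)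
  have "{\<eta> s |s. s \<in> nonpos_times T \<and> s \<le> t} = {\<gamma> s |s. s \<in> nonpos_times T \<and> s \<le> t}" for t
    by (auto simp: \<eta>_def nonpos_times_def)
  then show "alpha_limit T \<eta> = alpha_limit T \<gamma>"
    by (simp add: alpha_limit_def)
qed

lemma complete_orbit_backward: "complete_orbit T X \<phi> x \<gamma> \<Longrightarrow> backward_orbit T X \<phi> x \<gamma>"
  by (auto simp: complete_orbit_def backward_orbit_def nonpos_times_def)

lemma unstable_set_iff:
  "x \<in> unstable_set T X \<phi> S \<longleftrightarrow> (\<exists>\<gamma>. complete_orbit T X \<phi> x \<gamma> \<and> alpha_limit T \<gamma> \<subseteq> S)"
proof
  assume "x \<in> unstable_set T X \<phi> S"
  then obtain \<gamma> where "backward_orbit T X \<phi> x \<gamma>" "alpha_limit T \<gamma> \<subseteq> S"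
    unfolding unstable_set_def by blast
  then show "\<exists>\<gamma>. complete_orbit T X \<phi> x \<gamma> \<and> alpha_limit T \<gamma> \<subseteq> S"
    using backward_orbit_extends by metis
next
  assume "\<exists>\<gamma>. complete_orbit T X \<phi> x \<gamma> \<and> alpha_limit T \<gamma> \<subseteq> S"
  then obtain \<gamma> where \<gamma>: "complete_orbit T X \<phi> x \<gamma>" "alpha_limit T \<gamma> \<subseteq> S" by blast
  then have "x \<in> X" using complete_orbit_in_space[OF \<gamma>(1) zero_time] complete_orbit_zero[OF \<gamma>(1)] by simp
  then show "x \<in> unstable_set T X \<phi> S"
    unfolding unstable_set_def using \<gamma> complete_orbit_backward by blast
qed

text \<open>Time-1 preimages are chosen one after another inside \<open>S\<close>, and the flow
  fills in the times between them.\<close>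

lemma complete_orbit_in_invariant:
  assumes S: "invariant T X \<phi> S" and x: "x \<in> S"
  obtains \<gamma> where "complete_orbit T X \<phi> x \<gamma>" "\<And>t. t \<in> T \<Longrightarrow> \<gamma> t \<in> S"
proof -
  have "\<forall>y. \<exists>z. y \<in> S \<longrightarrow> z \<in> S \<and> \<phi> 1 z = y"
    using invariant_image[OF S nat_nonneg_time(3)] by (metis imageE)
  then obtain p where p: "\<And>y. y \<in> S \<Longrightarrow> p y \<in> S \<and> \<phi> 1 (p y) = y" by metis
  define b where "b n = (p ^^ n) x" for n
  have bS: "b n \<in> S" for n by (induction n) (auto simp: b_def x p)
  have b1: "\<phi> 1 (b (Suc n)) = b n" for n using p[OF bS[of n]] by (simp add: b_def)
  have SX: "S \<subseteq> X" by (rule invariant_subset_space[OF S])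
  \<comment> \<open>Any index \<open>n\<close> with \<open>- t \<le> real n\<close> gives the same
    point, by \<open>\<gamma>_eq\<close>. The least one is taken; for \<open>t \<ge> 0\<close>,
    \<open>nat\<close> makes it 0, so that the forward orbit of \<open>x\<close> results.\<close>
  define \<gamma> where "\<gamma> t = \<phi> (t + real (nat \<lceil>- t\<rceil>)) (b (nat \<lceil>- t\<rceil>))" for t
  have b_flow: "\<phi> (t + real (Suc n)) (b (Suc n)) = \<phi> (t + real n) (b n)"
    if "t + real n \<in> nonneg_times T" for t n
    using semigroup[OF nat_nonneg_time(3) that, of "b (Suc n)"] b1[of n] bS[of "Suc n"] SX
    by (auto simp: ac_simps)
  have \<gamma>_eq: "\<gamma> t = \<phi> (t + real n) (b n)" if t: "t \<in> T" "- t \<le> real n" for t n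
  proof -
    have "nat \<lceil>- t\<rceil> \<le> n" using t by linarith
    then show ?thesis
    proof (induction n rule: dec_induct)
      case base
      show ?case by (simp add: \<gamma>_def)
    next
      case (step m)
      have "0 \<le> t + real m" using step(1) by linarith
      then have "t + real m \<in> nonneg_times T" using t by (simp add: nonneg_times_def add_time)
      from b_flow[OF this]
      show ?case using step.IH by simp
    qed
  qed
  have \<gamma>S: "\<gamma> t \<in> S" if "t \<in> T" for t
    unfolding \<gamma>_def
    by (rule invariant_forward[OF S _ bS]) (use that in \<open>auto simp: nonneg_times_def add_time; linarith\<close>)
  have "complete_orbit T X \<phi> x \<gamma>"
    unfolding complete_orbit_def
  proof (intro conjI ballI)
    show "\<gamma> t \<in> X" if "t \<in> T" for t using \<gamma>S[OF that] SX by blast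
    show "\<gamma> 0 = x" using at_zero x SX by (auto simp: \<gamma>_def b_def)
    fix t s assume t: "t \<in> T" and s: "s \<in> nonneg_times T"
    obtain n where n: "- t \<le> real n" using real_arch_simple by blast
    have tn: "t + real n \<in> nonneg_times T" using n t by (simp add: nonneg_times_def add_time)
    have "\<gamma> (t + s) = \<phi> (t + s + real n) (b n)"
      by (rule \<gamma>_eq) (use s t n in \<open>auto simp: nonneg_times_def add_time\<close>)
    also have "\<dots> = \<phi> s (\<phi> (t + real n) (b n))"
      using semigroup[OF tn s, of "b n"] bS[of n] SX by (auto simp: ac_simps)
    finally show "\<gamma> (t + s) = \<phi> s (\<gamma> t)" using \<gamma>_eq[OF t n] by simp
  qed
  with \<gamma>S that show thesis by blast
qed

text \<open>The image of the compact set \<open>closure S\<close> is closed and contains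
  \<open>S\<close>, which gives surjectivity.\<close>

lemma invariant_closure:
  assumes "invariant T X \<phi> S"
  shows "invariant T X \<phi> (closure S)"
proof -
  have SX: "S \<subseteq> X" by (rule invariant_subset_space[OF assms])
  then have cX: "closure S \<subseteq> X" using closed_X by (rule closure_minimal)
  have "\<phi> t ` closure S = closure S" if t: "t \<in> nonneg_times T" for t
  proof (intro equalityI)
    have cont: "continuous_on (closure S) (\<phi> t)"
      unfolding continuous_on_sequentially o_def using flow_tendsto_const[OF _ _ _ t] cX by blast
    show "\<phi> t ` closure S \<subseteq> closure S"
      by (rule image_closure_subset[OF cont closed_closure])
        (use invariant_image[OF assms t] closure_subset[of S] in auto)
    have "closed (\<phi> t ` closure S)"
      using compact_continuous_image[OF cont compact_subspace[OF closed_closure cX]]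
      by (rule compact_imp_closed)
    moreover have "S \<subseteq> \<phi> t ` closure S"
      using invariant_image[OF assms t] closure_subset[of S] by blast
    ultimately show "closure S \<subseteq> \<phi> t ` closure S" by (rule closure_minimal[rotated])
  qed
  with cX show ?thesis by (simp add: invariant_def)
qed

lemma invariant_Inv: "invariant T X \<phi> (Inv T X \<phi> U)"
proof -
  have "\<phi> t ` \<Union>{S. invariant T X \<phi> S \<and> S \<subseteq> U} = \<Union>{S. invariant T X \<phi> S \<and> S \<subseteq> U}"
    if "t \<in> nonneg_times T" for t
    unfolding image_Union using invariant_image[OF _ that] by simp
  then show ?thesis
    unfolding Inv_def invariant_def[of T X \<phi> "\<Union>_"]
    using invariant_subset_space by (intro conjI ballI Union_least) simp_all
qed

lemma Inv_subset: "Inv T X \<phi> U \<subseteq> U"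
  by (auto simp: Inv_def)

lemma Inv_greatest: "invariant T X \<phi> S \<Longrightarrow> S \<subseteq> U \<Longrightarrow> S \<subseteq> Inv T X \<phi> U"
  by (auto simp: Inv_def)

text \<open>Bridge between the two lattices: the meets and tops of \<open>Att\<close> and
  \<open>Invset\<close> agree on closed forward-invariant sets, so that identities for
  \<open>\<nu>\<close> pass from one to the other.\<close>

lemma omega_limit_eq_Inv:
  assumes "closed K" "K \<subseteq> X" "\<And>t x. t \<in> nonneg_times T \<Longrightarrow> x \<in> K \<Longrightarrow> \<phi> t x \<in> K"
  shows "omega_limit T \<phi> K = Inv T X \<phi> K"
proof (rule equalityI)
  show "omega_limit T \<phi> K \<subseteq> Inv T X \<phi> K"
    by (rule Inv_greatest[OF omega_limit_invariant[OF assms(2)] omega_limit_subset[OF assms subset_refl]])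
  show "Inv T X \<phi> K \<subseteq> omega_limit T \<phi> K"
    by (rule invariant_subset_omega_limit[OF invariant_Inv Inv_subset])
qed

end

section \<open>Finite lattices of attractors\<close>

lemma join_irreducibleI:
  assumes "C \<in> \<A>" "B \<in> \<A>" "B \<subset> C" "\<And>A. A \<in> \<A> \<Longrightarrow> A \<subset> C \<Longrightarrow> A \<subseteq> B"
  shows "C \<in> join_irreducibles \<A>" and "the_pred \<A> C = B"
proof -
  have imm: "immediate_pred \<A> B C"
    using assms unfolding immediate_pred_def by blast
  have uniq: "B' = B" if "immediate_pred \<A> B' C" for B'
    using assms(2,3) assms(4)[of B'] that unfolding immediate_pred_def by blast
  show "the_pred \<A> C = B"
    unfolding the_pred_def using imm uniq by (rule the_equality)
  have ex1: "\<exists>!B. immediate_pred \<A> B C" using imm uniq by (rule ex1I)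
  show "C \<in> join_irreducibles \<A>"
    using ex1 assms(1,3) unfolding join_irreducibles_def by auto
qed

text \<open>For the last claim: among the finitely many members strictly below \<open>C\<close>, a
  maximal one above \<open>A\<close> is an immediate predecessor, hence the only one.\<close>

lemma join_irreducible_pred:
  assumes "finite \<A>" "C \<in> join_irreducibles \<A>"
  shows "the_pred \<A> C \<in> \<A>" "the_pred \<A> C \<subset> C"
    and "\<And>A. A \<in> \<A> \<Longrightarrow> A \<subset> C \<Longrightarrow> A \<subseteq> the_pred \<A> C"
proof -
  have ex1: "\<exists>!B. immediate_pred \<A> B C"
    using assms(2) unfolding join_irreducibles_def by blast
  then have "immediate_pred \<A> (the_pred \<A> C) C"
    unfolding the_pred_def by (rule theI')
  then show "the_pred \<A> C \<in> \<A>" "the_pred \<A> C \<subset> C"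
    unfolding immediate_pred_def by blast+
  fix A assume A: "A \<in> \<A>" "A \<subset> C"
  then have "A \<in> {B \<in> \<A>. B \<subset> C}" "finite {B \<in> \<A>. B \<subset> C}" using assms(1) by auto
  then obtain B where B: "B \<in> {B \<in> \<A>. B \<subset> C}" "A \<subseteq> B"
      and max: "\<forall>B'\<in>{B \<in> \<A>. B \<subset> C}. B \<subseteq> B' \<longrightarrow> B' = B"
    using finite_has_maximal2[of "{B \<in> \<A>. B \<subset> C}" A] by (smt (verit, best))
  have "immediate_pred \<A> B C"
    using B(1) max unfolding immediate_pred_def by blast
  with ex1 \<open>immediate_pred \<A> (the_pred \<A> C) C\<close> have "B = the_pred \<A> C" by blast
  with B(2) show "A \<subseteq> the_pred \<A> C" by simp
qed

context compact_dynamical_system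
begin

lemma attractorE:
  assumes "attractor T X \<phi> A"
  obtains W where "open W" "A \<subseteq> W" "omega_limit T \<phi> (X \<inter> W) = A"
  using assms unfolding attractor_def openin_open by auto

lemma attractor_invariant: "attractor T X \<phi> A \<Longrightarrow> invariant T X \<phi> A"
  using omega_limit_invariant[of "X \<inter> _"] by (metis attractorE inf_le1)

lemma attractor_closed: "attractor T X \<phi> A \<Longrightarrow> closed A"
  using closed_omega_limit by (metis attractorE)

text \<open>The orbit of \<open>x\<close> enters the neighborhood whose omega-limit set is
  \<open>A\<close>, and starting the orbit later does not change its limit set.\<close>

lemma attractor_omega_undivided:
  assumes A: "attractor T X \<phi> A" and x: "x \<in> X" and meets: "omega_limit T \<phi> {x} \<inter> A \<noteq> {}"
  shows "omega_limit T \<phi> {x} \<subseteq> A"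
proof -
  obtain W where W: "open W" "A \<subseteq> W" "omega_limit T \<phi> (X \<inter> W) = A" using attractorE[OF A] .
  obtain y where y: "y \<in> tail_limit T (\<lambda>s. \<phi> s ` {x})" "y \<in> A"
    using meets unfolding omega_limit_eq_tail_limit by blast
  obtain s z where sz: "\<And>n. s n \<in> nonneg_times T" "\<And>n. z n \<in> \<phi> (s n) ` {x}" "z \<longlonglongrightarrow> y"
    using tail_limitE[OF y(1)] by metis
  have "\<forall>\<^sub>F n in sequentially. z n \<in> W"
    using topological_tendstoD[OF sz(3) W(1)] y(2) W(2) by blast
  then obtain n where "z n \<in> W" by (metis eventually_sequentially le_refl)
  then have "\<phi> (s n) ` {x} \<subseteq> X \<inter> W" using sz(2)[of n] maps_to[OF sz(1) x] by auto
  from omega_limit_mono[OF this, of T \<phi>] show ?thesis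
    using omega_limit_flow[OF _ sz(1)[of n], of "{x}"] x W(3) by simp
qed

text \<open>The orbit is in \<open>W\<close> at arbitrarily early times, so
  \<open>\<gamma> t\<close> is the image of points of \<open>W\<close> under arbitrarily long flow
  times and belongs to \<open>\<omega>(X \<inter> W) = A\<close>.\<close>

lemma attractor_alpha_in:
  assumes A: "attractor T X \<phi> A" and \<gamma>: "complete_orbit T X \<phi> x \<gamma>"
    and meets: "alpha_limit T \<gamma> \<inter> A \<noteq> {}" and t: "t \<in> T"
  shows "\<gamma> t \<in> A"
proof -
  obtain W where W: "open W" "A \<subseteq> W" "omega_limit T \<phi> (X \<inter> W) = A" using attractorE[OF A] .
  obtain y where y: "y \<in> tail_limit T (\<lambda>s. {\<gamma> (- s)})" "y \<in> A"
    using meets unfolding alpha_limit_tail by blast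
  obtain s z where sz: "\<And>n. s n \<in> nonneg_times T" "\<And>n. real n \<le> s n" "\<And>n. z n \<in> {\<gamma> (- s n)}" "z \<longlonglongrightarrow> y"
    using tail_limitE[OF y(1)] by metis
  have "\<forall>\<^sub>F n in sequentially. z n \<in> W"
    using topological_tendstoD[OF sz(4) W(1)] y(2) W(2) by blast
  then obtain N where N: "\<And>n. N \<le> n \<Longrightarrow> \<gamma> (- s n) \<in> W"
    using sz(3) by (auto simp: eventually_sequentially)
  have "\<gamma> t \<in> closure (\<Union>s\<in>{s \<in> nonneg_times T. \<tau> \<le> s}. \<phi> s ` (X \<inter> W))" if \<tau>: "\<tau> \<in> nonneg_times T" for \<tau>
  proof -
    \<comment> \<open>\<open>N\<close> ensures that the orbit is in \<open>W\<close> at time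
      \<open>- s n\<close>, the other term that it then flows for time at least
      \<open>\<tau>\<close>.\<close>
    define n where "n = max N (nat \<lceil>\<tau> - t\<rceil>)"
    have "\<tau> - t \<le> real n" unfolding n_def by linarith
    then have ge: "\<tau> \<le> t + s n" using sz(2)[of n] by linarith
    have sn: "- s n \<in> T" using sz(1)[of n] by (simp add: minus_time nonneg_time_in)
    have "- s n \<le> t" using ge \<tau> by (simp add: nonneg_times_def)
    then have "\<gamma> t = \<phi> (t + s n) (\<gamma> (- s n))"
      using complete_orbit_flow_diff[OF \<gamma> sn t] by simp
    moreover have "\<gamma> (- s n) \<in> X \<inter> W"
      using complete_orbit_in_space[OF \<gamma> sn] N[of n] by (simp add: n_def)
    moreover have "t + s n \<in> nonneg_times T"
      using ge \<tau> diff_time[OF t sn] by (simp add: nonneg_times_def)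
    ultimately have "\<gamma> t \<in> (\<Union>s\<in>{s \<in> nonneg_times T. \<tau> \<le> s}. \<phi> s ` (X \<inter> W))"
      using ge by blast
    then show ?thesis by (rule subsetD[OF closure_subset])
  qed
  then have "\<gamma> t \<in> omega_limit T \<phi> (X \<inter> W)" unfolding omega_limit_def by (rule INT_I)
  then show ?thesis unfolding W(3) .
qed

end

locale finite_attractor_lattice = compact_dynamical_system T X \<phi>
  for T :: "real set" and X :: "'a::metric_space set" and \<phi> :: "real \<Rightarrow> 'a \<Rightarrow> 'a" +
  fixes \<A> :: "'a set set"
  assumes finite_attractors: "finite \<A>"
    and sublattice: "sublattice \<A> (Att T X \<phi>)"
begin

lemma member_attractor: "A \<in> \<A> \<Longrightarrow> attractor T X \<phi> A"
  and empty_member: "{} \<in> \<A>"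
  and top_member: "omega_limit T \<phi> X \<in> \<A>"
  and union_member: "A \<in> \<A> \<Longrightarrow> B \<in> \<A> \<Longrightarrow> A \<union> B \<in> \<A>"
  and meet_member: "A \<in> \<A> \<Longrightarrow> B \<in> \<A> \<Longrightarrow> omega_limit T \<phi> (A \<inter> B) \<in> \<A>"
  using sublattice unfolding sublattice_def Att_def by auto

lemmas member_invariant = attractor_invariant[OF member_attractor]
  and member_closed = attractor_closed[OF member_attractor]

lemma Union_member:
  assumes "\<B> \<subseteq> \<A>"
  shows "\<Union>\<B> \<in> \<A>"
proof -
  have "finite \<B>" using assms finite_attractors finite_subset by blast
  then show ?thesis using assms
    by (induction \<B> rule: finite_induct) (auto simp: empty_member intro: union_member)
qed

lemma meet_subset:
  assumes "A \<in> \<A>" "B \<in> \<A>"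
  shows "omega_limit T \<phi> (A \<inter> B) \<subseteq> A \<inter> B"
proof (rule omega_limit_subset[OF _ _ _ subset_refl])
  show "closed (A \<inter> B)" using assms member_closed by blast
  show "A \<inter> B \<subseteq> X" using invariant_subset_space[OF member_invariant[OF assms(1)]] by blast
  show "\<phi> t x \<in> A \<inter> B" if "t \<in> nonneg_times T" "x \<in> A \<inter> B" for t x
    using that assms member_invariant invariant_forward by blast
qed

text \<open>
  Limit sets of points and of orbits lie inside or outside of every attractor. The smallest member
  containing such a set \<open>S\<close> is join-irreducible, because all smaller members miss \<open>S\<close>.
\<close>

lemma undivided_in_morse_set:
  assumes S: "invariant T X \<phi> S" "closed S" "S \<noteq> {}"
    and undivided: "\<And>A. A \<in> \<A> \<Longrightarrow> S \<inter> A \<noteq> {} \<Longrightarrow> S \<subseteq> A"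
  obtains C where "C \<in> join_irreducibles \<A>" "S \<subseteq> morse_set T X \<phi> \<A> C"
    "\<And>A. A \<in> \<A> \<Longrightarrow> S \<inter> A \<noteq> {} \<Longrightarrow> C \<subseteq> A" "S \<inter> the_pred \<A> C = {}"
proof -
  let ?F = "{A \<in> \<A>. S \<subseteq> A}"
  have "omega_limit T \<phi> X \<in> ?F"
    using top_member invariant_subset_omega_limit[OF S(1) invariant_subset_space[OF S(1)]] by blast
  then have "\<exists>C\<in>?F. \<forall>A\<in>?F. A \<subseteq> C \<longrightarrow> C = A"
    by (intro finite_has_minimal) (use finite_attractors in auto)
  then obtain C where C: "C \<in> ?F" and min: "\<forall>A\<in>?F. A \<subseteq> C \<longrightarrow> C = A" ..
  \<comment> \<open>\<open>C \<inter> A\<close> need not be a member. The meet replaces it: it still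
    contains \<open>S\<close>, because \<open>S\<close> is invariant.\<close>
  have least: "C \<subseteq> A" if A: "A \<in> \<A>" "S \<inter> A \<noteq> {}" for A
  proof -
    have "S \<subseteq> C \<inter> A" using C undivided[OF A] by blast
    then have "omega_limit T \<phi> (C \<inter> A) \<in> ?F"
      using invariant_subset_omega_limit[OF S(1)] meet_member A(1) C by blast
    then show ?thesis using min meet_subset[of C A] C A(1) by blast
  qed
  \<comment> \<open>Finiteness makes this union a member, and so the largest one strictly below
    \<open>C\<close>; it differs from \<open>C\<close> since it misses the nonempty set
    \<open>S\<close>.\<close>
  define B where "B = \<Union>{A \<in> \<A>. A \<subset> C}"
  have B: "B \<in> \<A>" unfolding B_def by (rule Union_member) blast
  have SB: "S \<inter> B = {}" using least unfolding B_def by blast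
  have "B \<subset> C" using SB C S(3) unfolding B_def by blast
  moreover have "A \<subseteq> B" if "A \<in> \<A>" "A \<subset> C" for A using that unfolding B_def by blast
  ultimately have J: "C \<in> join_irreducibles \<A>" "the_pred \<A> C = B"
    using join_irreducibleI[of C \<A> B] C B by auto
  have "S \<subseteq> dual_repeller T X \<phi> B"
    unfolding dual_repeller_def
    using omega_limit_point_subset[OF S(2,1)] SB invariant_subset_space[OF S(1)] by blast
  then have "S \<subseteq> morse_set T X \<phi> \<A> C" using C J(2) unfolding morse_set_def by simp
  moreover have "S \<inter> the_pred \<A> C = {}" using SB J(2) by simp
  ultimately show thesis using that[OF J(1)] least by blast
qed

lemma omega_in_morse_set:
  assumes "x \<in> X"
  obtains C where "C \<in> join_irreducibles \<A>" "omega_limit T \<phi> {x} \<subseteq> morse_set T X \<phi> \<A> C"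
    "\<And>A. A \<in> \<A> \<Longrightarrow> omega_limit T \<phi> {x} \<inter> A \<noteq> {} \<Longrightarrow> C \<subseteq> A"
    "omega_limit T \<phi> {x} \<inter> the_pred \<A> C = {}"
  using undivided_in_morse_set[OF omega_limit_invariant[of "{x}"] closed_omega_limit
      omega_limit_nonempty[OF assms] attractor_omega_undivided[OF member_attractor assms]] assms
  by blast

lemma alpha_in_morse_set:
  assumes \<gamma>: "complete_orbit T X \<phi> x \<gamma>"
  obtains C where "C \<in> join_irreducibles \<A>" "alpha_limit T \<gamma> \<subseteq> morse_set T X \<phi> \<A> C"
    "\<And>A. A \<in> \<A> \<Longrightarrow> alpha_limit T \<gamma> \<inter> A \<noteq> {} \<Longrightarrow> C \<subseteq> A"
proof -
  have "alpha_limit T \<gamma> \<subseteq> A" if "A \<in> \<A>" "alpha_limit T \<gamma> \<inter> A \<noteq> {}" for A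
    using alpha_limit_subset[OF attractor_alpha_in[OF member_attractor[OF that(1)] \<gamma> that(2)]
        member_closed[OF that(1)]] .
  from undivided_in_morse_set[OF alpha_limit_invariant[OF \<gamma>] closed_alpha_limit
      alpha_limit_nonempty[OF \<gamma>] this]
  show thesis using that by metis
qed

lemma join_irreducible_member: "C \<in> join_irreducibles \<A> \<Longrightarrow> C \<in> \<A>"
  by (simp add: join_irreducibles_def)

lemma morse_set_subset: "morse_set T X \<phi> \<A> C \<subseteq> C"
  by (simp add: morse_set_def)

text \<open>If \<open>D\<close> were not contained in \<open>A\<close>, the meet of the two would
  lie below the predecessor of \<open>D\<close>. It contains \<open>\<omega>(x)\<close> for a point
  \<open>x\<close> of the Morse set in \<open>A\<close>, whereas \<open>\<omega>(x)\<close> misses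
  that predecessor.\<close>

lemma morse_set_meets:
  assumes D: "D \<in> join_irreducibles \<A>" and A: "A \<in> \<A>"
    and meets: "morse_set T X \<phi> \<A> D \<inter> A \<noteq> {}"
  shows "D \<subseteq> A"
proof (rule ccontr)
  assume "\<not> D \<subseteq> A"
  note D' = join_irreducible_member[OF D]
  obtain x where x: "x \<in> D" "x \<in> X" "omega_limit T \<phi> {x} \<inter> the_pred \<A> D = {}" "x \<in> A"
    using meets unfolding morse_set_def dual_repeller_def by blast
  have "omega_limit T \<phi> {x} \<subseteq> D \<inter> A"
    using omega_limit_point_subset[OF member_closed member_invariant] x A D' by blast
  then have "omega_limit T \<phi> {x} \<subseteq> omega_limit T \<phi> (D \<inter> A)"
    using invariant_subset_omega_limit omega_limit_invariant[of "{x}"] x(2) by blast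
  moreover have "omega_limit T \<phi> (D \<inter> A) \<subset> D"
    using meet_subset[OF D' A] \<open>\<not> D \<subseteq> A\<close> by blast
  then have "omega_limit T \<phi> (D \<inter> A) \<subseteq> the_pred \<A> D"
    using join_irreducible_pred(3)[OF finite_attractors D] meet_member[OF D' A] by blast
  ultimately show False using x(3) omega_limit_nonempty[OF x(2)] by blast
qed

lemma connecting_orbit:
  assumes \<gamma>: "complete_orbit T X \<phi> x \<gamma>" and x: "x \<notin> \<Union>(morse_set T X \<phi> \<A> ` join_irreducibles \<A>)"
  obtains C C' where "C \<in> join_irreducibles \<A>" "C' \<in> join_irreducibles \<A>" "C \<subseteq> C'"
    "morse_set T X \<phi> \<A> C \<noteq> morse_set T X \<phi> \<A> C'"
    "omega_limit T \<phi> {x} \<subseteq> morse_set T X \<phi> \<A> C" "alpha_limit T \<gamma> \<subseteq> morse_set T X \<phi> \<A> C'"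
proof -
  have xX: "x \<in> X" using complete_orbit_in_space[OF \<gamma> zero_time] complete_orbit_zero[OF \<gamma>] by simp
  obtain C where C: "C \<in> join_irreducibles \<A>" "omega_limit T \<phi> {x} \<subseteq> morse_set T X \<phi> \<A> C"
      "\<And>A. A \<in> \<A> \<Longrightarrow> omega_limit T \<phi> {x} \<inter> A \<noteq> {} \<Longrightarrow> C \<subseteq> A"
      "omega_limit T \<phi> {x} \<inter> the_pred \<A> C = {}"
    using omega_in_morse_set[OF xX] by blast
  obtain C' where C': "C' \<in> join_irreducibles \<A>" "alpha_limit T \<gamma> \<subseteq> morse_set T X \<phi> \<A> C'"
      "\<And>A. A \<in> \<A> \<Longrightarrow> alpha_limit T \<gamma> \<inter> A \<noteq> {} \<Longrightarrow> C' \<subseteq> A"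
    using alpha_in_morse_set[OF \<gamma>] by blast
  note mem = join_irreducible_member[OF C(1)] join_irreducible_member[OF C'(1)]
  have "alpha_limit T \<gamma> \<inter> C' \<noteq> {}"
    using C'(2) morse_set_subset alpha_limit_nonempty[OF \<gamma>] by blast
  then have "x \<in> C'"
    using attractor_alpha_in[OF member_attractor[OF mem(2)] \<gamma> _ zero_time] complete_orbit_zero[OF \<gamma>] by simp
  then have "omega_limit T \<phi> {x} \<subseteq> C'"
    by (rule omega_limit_point_subset[OF member_closed[OF mem(2)] member_invariant[OF mem(2)]])
  then have le: "C \<subseteq> C'" using C(3)[OF mem(2)] omega_limit_nonempty[OF xX] by blast
  \<comment> \<open>Strictness concerns the Morse sets, not the members they come from. If they
    agreed, then \<open>C = C'\<close>, so \<open>x \<in> C\<close> while \<open>\<omega>(x)\<close>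
    misses the predecessor, which puts \<open>x\<close> in the Morse set.\<close>
  have "morse_set T X \<phi> \<A> C \<noteq> morse_set T X \<phi> \<A> C'"
  proof
    assume "morse_set T X \<phi> \<A> C = morse_set T X \<phi> \<A> C'"
    then have "alpha_limit T \<gamma> \<inter> C \<noteq> {}"
      using C'(2) morse_set_subset[of C] alpha_limit_nonempty[OF \<gamma>] by blast
    then have "C = C'" using C'(3)[OF mem(1)] le by blast
    with \<open>x \<in> C'\<close> C(4) xX have "x \<in> morse_set T X \<phi> \<A> C"
      unfolding morse_set_def dual_repeller_def by blast
    with x C(1) show False by blast
  qed
  with C(1) C'(1) le show thesis using C(2) C'(2) by (rule that)
qed

text \<open>An orbit through \<open>x\<close> inside \<open>A\<close> has a nonempty alpha-limit set
  in \<open>A\<close>. The Morse set containing it belongs to the least member meeting it, hence to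
  a member below \<open>A\<close>.\<close>

lemma in_unstable_morse_set:
  assumes "A \<in> \<A>" "x \<in> A"
  obtains C where "C \<in> join_irreducibles \<A>" "C \<subseteq> A" "x \<in> unstable_set T X \<phi> (morse_set T X \<phi> \<A> C)"
    "morse_set T X \<phi> \<A> C \<noteq> {}"
proof -
  obtain \<gamma> where \<gamma>: "complete_orbit T X \<phi> x \<gamma>" "\<And>t. t \<in> T \<Longrightarrow> \<gamma> t \<in> A"
    using complete_orbit_in_invariant[OF member_invariant[OF assms(1)] assms(2)] by blast
  have \<alpha>: "alpha_limit T \<gamma> \<subseteq> A" "alpha_limit T \<gamma> \<noteq> {}"
    using alpha_limit_subset[OF \<gamma>(2) member_closed[OF assms(1)]] alpha_limit_nonempty[OF \<gamma>(1)] by auto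
  obtain C where "C \<in> join_irreducibles \<A>" "alpha_limit T \<gamma> \<subseteq> morse_set T X \<phi> \<A> C"
      "\<And>A. A \<in> \<A> \<Longrightarrow> alpha_limit T \<gamma> \<inter> A \<noteq> {} \<Longrightarrow> C \<subseteq> A"
    using alpha_in_morse_set[OF \<gamma>(1)] by blast
  then show thesis using that[of C] \<alpha> \<gamma>(1) assms(1) unstable_set_iff by blast
qed

lemma unstable_set_subset:
  assumes "A \<in> \<A>" "M \<subseteq> A"
  shows "unstable_set T X \<phi> M \<subseteq> A"
proof
  fix x assume "x \<in> unstable_set T X \<phi> M"
  then obtain \<gamma> where \<gamma>: "complete_orbit T X \<phi> x \<gamma>" "alpha_limit T \<gamma> \<subseteq> M"
    unfolding unstable_set_iff by blast
  then have "alpha_limit T \<gamma> \<inter> A \<noteq> {}" using alpha_limit_nonempty[OF \<gamma>(1)] assms(2) by blast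
  from attractor_alpha_in[OF member_attractor[OF assms(1)] \<gamma>(1) this zero_time]
  show "x \<in> A" using complete_orbit_zero[OF \<gamma>(1)] by simp
qed

text \<open>An attractor \<open>A\<close> corresponds to the Morse sets of the join-irreducible
  members inside \<open>A\<close>, and a down-set to the union of the join-irreducible members whose
  Morse sets it contains.\<close>

theorem attractors_eq_nu_image:
  assumes nonempty: "\<And>C. C \<in> join_irreducibles \<A> \<Longrightarrow> morse_set T X \<phi> \<A> C \<noteq> {}"
  shows "\<A> = nu T X \<phi> ` elems (Downsets (morse_rep T X \<phi> \<A>))"
proof -
  let ?m = "morse_set T X \<phi> \<A>" and ?J = "join_irreducibles \<A>"
  have downset_iff: "\<alpha> \<in> elems (Downsets (morse_rep T X \<phi> \<A>)) \<longleftrightarrow> \<alpha> \<subseteq> ?m ` ?J \<and>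
      (\<forall>C\<in>?J. \<forall>D\<in>?J. C \<subseteq> D \<longrightarrow> ?m D \<in> \<alpha> \<longrightarrow> ?m C \<in> \<alpha>)" (is "?L = ?R") for \<alpha>
  proof
    show "?L \<Longrightarrow> ?R" unfolding Downsets_def morse_rep_def by fastforce
    show "?R \<Longrightarrow> ?L" unfolding Downsets_def morse_rep_def by auto
  qed
  have "A \<in> nu T X \<phi> ` elems (Downsets (morse_rep T X \<phi> \<A>))" if A: "A \<in> \<A>" for A
  proof (rule image_eqI)
    let ?\<alpha> = "?m ` {C \<in> ?J. C \<subseteq> A}"
    show "A = nu T X \<phi> ?\<alpha>"
    proof
      show "A \<subseteq> nu T X \<phi> ?\<alpha>"
      proof
        fix x assume "x \<in> A"
        then obtain C where "C \<in> ?J" "C \<subseteq> A" "x \<in> unstable_set T X \<phi> (?m C)"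
          using in_unstable_morse_set[OF A] by metis
        then show "x \<in> nu T X \<phi> ?\<alpha>" unfolding nu_def by blast
      qed
      show "nu T X \<phi> ?\<alpha> \<subseteq> A"
        unfolding nu_def using unstable_set_subset[OF A] morse_set_subset by blast
    qed
    show "?\<alpha> \<in> elems (Downsets (morse_rep T X \<phi> \<A>))"
      unfolding downset_iff
    proof (intro conjI ballI impI)
      \<comment> \<open>\<open>?m D\<close> may be listed in \<open>?\<alpha>\<close> on account of
        another member. It lies in \<open>A\<close> in any case, and being nonempty it forces
        \<open>D \<subseteq> A\<close>.\<close>
      fix C D assume CD: "C \<in> ?J" "D \<in> ?J" "C \<subseteq> D" "?m D \<in> ?\<alpha>"
      then have "?m D \<inter> A \<noteq> {}" using nonempty[OF CD(2)] morse_set_subset by blast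
      then have "D \<subseteq> A" using morse_set_meets[OF CD(2) A] by blast
      then show "?m C \<in> ?\<alpha>" using CD by blast
    qed blast
  qed
  moreover have "nu T X \<phi> \<alpha> \<in> \<A>" if \<alpha>: "\<alpha> \<in> elems (Downsets (morse_rep T X \<phi> \<A>))" for \<alpha>
  proof -
    have \<alpha>': "\<alpha> \<subseteq> ?m ` ?J" "\<And>C D. C \<in> ?J \<Longrightarrow> D \<in> ?J \<Longrightarrow> C \<subseteq> D \<Longrightarrow> ?m D \<in> \<alpha> \<Longrightarrow> ?m C \<in> \<alpha>"
      using \<alpha> unfolding downset_iff by auto
    have "nu T X \<phi> \<alpha> = \<Union>{D \<in> ?J. ?m D \<in> \<alpha>}"
    proof
      show "nu T X \<phi> \<alpha> \<subseteq> \<Union>{D \<in> ?J. ?m D \<in> \<alpha>}"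
        unfolding nu_def
      proof (rule UN_least)
        fix M assume M: "M \<in> \<alpha>"
        then obtain D where D: "D \<in> ?J" "M = ?m D" using \<alpha>'(1) by blast
        have "unstable_set T X \<phi> M \<subseteq> D"
          by (rule unstable_set_subset[OF join_irreducible_member[OF D(1)]]) (simp add: D morse_set_subset)
        then show "unstable_set T X \<phi> M \<subseteq> \<Union>{D \<in> ?J. ?m D \<in> \<alpha>}" using D M by blast
      qed
      show "\<Union>{D \<in> ?J. ?m D \<in> \<alpha>} \<subseteq> nu T X \<phi> \<alpha>"
      proof
        fix x assume "x \<in> \<Union>{D \<in> ?J. ?m D \<in> \<alpha>}"
        then obtain D where D: "D \<in> ?J" "?m D \<in> \<alpha>" "x \<in> D" by blast
        obtain C where "C \<in> ?J" "C \<subseteq> D" "x \<in> unstable_set T X \<phi> (?m C)"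
          using in_unstable_morse_set[OF join_irreducible_member[OF D(1)] D(3)] by blast
        then show "x \<in> nu T X \<phi> \<alpha>" using \<alpha>'(2) D unfolding nu_def by blast
      qed
    qed
    also have "\<dots> \<in> \<A>" by (rule Union_member) (use join_irreducible_member in blast)
    finally show ?thesis .
  qed
  ultimately show ?thesis by blast
qed

end

section \<open>Morse decompositions\<close>

lemma compact_infdist_separated:
  fixes M C :: "'a::metric_space set"
  assumes "closed M" "M \<noteq> {}" "compact C" "C \<inter> M = {}"
  obtains e where "0 < e" "\<And>q. q \<in> C \<Longrightarrow> e < infdist q M"
proof (cases "C = {}")
  case True
  then show thesis using that[of 1] by simp
next
  case False
  obtain c where c: "c \<in> C" "\<And>q. q \<in> C \<Longrightarrow> infdist c M \<le> infdist q M"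
    using continuous_attains_inf[OF assms(3) False, of "\<lambda>q. infdist q M"]
      continuous_on_infdist[OF continuous_on_id] by blast
  have "0 < infdist c M"
    using infdist_pos_not_in_closed[OF assms(1,2)] c(1) assms(4) by blast
  \<comment> \<open>Halving the minimal distance makes the bound strict: \<open>C\<close> then lies
    in the open set \<open>{q. e < infdist q M}\<close>.\<close>
  then show thesis
    using that[of "infdist c M / 2"] c(2) by fastforce
qed

text \<open>Serves the case of bounded exit times: at infinitely many indices the flow takes the
  exit point to the initial point of its segment, whose distance to the Morse set tends to
  0.\<close>

lemma tendsto_eq_0_if_frequently_eq:
  fixes a c :: "nat \<Rightarrow> real"
  assumes "a \<longlonglongrightarrow> A" "c \<longlonglongrightarrow> 0" "\<exists>\<^sub>F n in sequentially. a n = c n"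
  shows "A = 0"
proof (rule ccontr)
  assume "A \<noteq> 0"
  have "(\<lambda>n. a n - c n) \<longlonglongrightarrow> A - 0" by (rule tendsto_diff[OF assms(1,2)])
  then have "\<forall>\<^sub>F n in sequentially. a n - c n \<noteq> 0"
    using tendsto_imp_eventually_ne \<open>A \<noteq> 0\<close> by fastforce
  then have "\<forall>\<^sub>F n in sequentially. a n \<noteq> c n" by (rule eventually_mono) simp
  with assms(3) show False by (simp add: frequently_def)
qed

locale morse_decomposition = compact_dynamical_system T X \<phi>
  for T :: "real set" and X :: "'a::metric_space set" and \<phi> :: "real \<Rightarrow> 'a \<Rightarrow> 'a" +
  fixes MM :: "'a set set" and r :: "'a set rel"
  assumes finite_MM: "finite MM" and order: "partial_order_on MM r"
    and morse_sets: "\<And>M. M \<in> MM \<Longrightarrow> M \<noteq> {} \<and> compact M \<and> invariant T X \<phi> M"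
    and disjoint_MM: "pairwise disjnt MM"
    and omega_in: "\<And>x. x \<in> X \<Longrightarrow> \<exists>M\<in>MM. omega_limit T \<phi> {x} \<subseteq> M"
    and connecting: "\<And>x \<gamma>. complete_orbit T X \<phi> x \<gamma> \<Longrightarrow> x \<notin> \<Union>MM \<Longrightarrow>
      \<exists>M\<in>MM. \<exists>M'\<in>MM. (M, M') \<in> r \<and> M \<noteq> M' \<and> omega_limit T \<phi> {x} \<subseteq> M \<and> alpha_limit T \<gamma> \<subseteq> M'"
begin

lemma order_refl: "M \<in> MM \<Longrightarrow> (M, M) \<in> r"
  and order_trans: "(M, N) \<in> r \<Longrightarrow> (N, P) \<in> r \<Longrightarrow> (M, P) \<in> r"
  and order_antisym: "(M, N) \<in> r \<Longrightarrow> (N, M) \<in> r \<Longrightarrow> M = N"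
  and order_carrier: "r \<subseteq> MM \<times> MM"
  using partial_order_onD[OF order] order
  by (auto simp: refl_on_def partial_order_on_def preorder_on_def dest: transD antisymD)

lemma maximal_exists:
  assumes "\<B> \<subseteq> MM" "\<B> \<noteq> {}"
  obtains M where "M \<in> \<B>" "\<And>N. N \<in> \<B> \<Longrightarrow> (M, N) \<in> r \<Longrightarrow> N = M"
proof -
  have "\<exists>M\<in>\<B>. \<forall>N\<in>\<B>. N \<noteq> M \<longrightarrow> \<not> ((M, N) \<in> r \<and> M \<noteq> N)"
  proof (rule Finite_Set.bex_max_element)
    show "finite \<B>" using assms(1) finite_MM by (rule finite_subset)
    show "asymp_on \<B> (\<lambda>M N. (M, N) \<in> r \<and> M \<noteq> N)"
      by (rule asymp_onI) (use order_antisym in blast)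
    show "transp_on \<B> (\<lambda>M N. (M, N) \<in> r \<and> M \<noteq> N)"
      by (rule transp_onI) (use order_antisym order_trans in blast)
  qed (use assms(2) in auto)
  then show thesis using that by blast
qed

lemma morse_nonempty: "M \<in> MM \<Longrightarrow> M \<noteq> {}"
  and morse_compact: "M \<in> MM \<Longrightarrow> compact M"
  and morse_invariant: "M \<in> MM \<Longrightarrow> invariant T X \<phi> M"
  and morse_closed: "M \<in> MM \<Longrightarrow> closed M"
  using morse_sets by (auto intro: compact_imp_closed)

lemma morse_unique: "M \<in> MM \<Longrightarrow> N \<in> MM \<Longrightarrow> x \<in> M \<Longrightarrow> x \<in> N \<Longrightarrow> M = N"
  using disjoint_MM unfolding pairwise_def disjnt_def by blast

lemma morse_unique_subset:
  "M \<in> MM \<Longrightarrow> N \<in> MM \<Longrightarrow> S \<subseteq> M \<Longrightarrow> S \<subseteq> N \<Longrightarrow> S \<noteq> {} \<Longrightarrow> M = N"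
  using morse_unique by blast

lemma omega_limit_morse: "M \<in> MM \<Longrightarrow> x \<in> M \<Longrightarrow> omega_limit T \<phi> {x} \<subseteq> M"
  by (rule omega_limit_point_subset[OF morse_closed morse_invariant])

text \<open>The connecting condition is silent about points of Morse sets, yet such a point can have
  a backward orbit from elsewhere. If the orbit is outside the Morse sets at some time up to 0, the
  condition applies there, and a shift in time changes neither limit set. Otherwise invariance and
  disjointness keep it in one Morse set.\<close>

lemma orbit_ends:
  assumes \<gamma>: "complete_orbit T X \<phi> x \<gamma>"
  obtains M M' where "M \<in> MM" "M' \<in> MM" "(M, M') \<in> r" "omega_limit T \<phi> {x} \<subseteq> M" "alpha_limit T \<gamma> \<subseteq> M'"
proof (cases "\<exists>t\<in>T. t \<le> 0 \<and> \<gamma> t \<notin> \<Union>MM")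
  case True
  then obtain t where t: "t \<in> T" "t \<le> 0" "\<gamma> t \<notin> \<Union>MM" by blast
  have mt: "- t \<in> nonneg_times T" using t by (simp add: nonneg_times_def minus_time)
  have "x = \<phi> (- t) (\<gamma> t)"
    using complete_orbit_flow[OF \<gamma> t(1) mt] complete_orbit_zero[OF \<gamma>] by simp
  then have \<omega>: "omega_limit T \<phi> {\<gamma> t} = omega_limit T \<phi> {x}"
    using omega_limit_flow[OF _ mt, of "{\<gamma> t}"] complete_orbit_in_space[OF \<gamma> t(1)] by simp
  show thesis
    using connecting[OF complete_orbit_shift[OF \<gamma> t(1)] t(3)] that
    unfolding \<omega> alpha_limit_shift[OF t(1)] by metis
next
  case False
  then have "\<gamma> 0 \<in> \<Union>MM" by (meson order.refl zero_time)
  then obtain M where M: "M \<in> MM" "\<gamma> 0 \<in> M" by blast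
  have "\<gamma> t \<in> M" if t: "t \<in> T" for t
  proof (cases "t \<le> 0")
    case True
    then obtain N where N: "N \<in> MM" "\<gamma> t \<in> N" using False t by blast
    have mt: "- t \<in> nonneg_times T" using t True by (simp add: nonneg_times_def minus_time)
    have "\<gamma> 0 \<in> N"
      using invariant_forward[OF morse_invariant[OF N(1)] mt N(2)] complete_orbit_flow[OF \<gamma> t mt]
      by simp
    then have "M = N" using morse_unique[OF M(1) N(1) M(2)] by simp
    with N(2) show ?thesis by simp
  next
    case False
    then have t': "t \<in> nonneg_times T" using t by (simp add: nonneg_times_def)
    show ?thesis
      using invariant_forward[OF morse_invariant[OF M(1)] t' M(2)]
        complete_orbit_flow[OF \<gamma> zero_time t'] by simp
  qed
  then have "alpha_limit T \<gamma> \<subseteq> M" using alpha_limit_subset morse_closed[OF M(1)] by blast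
  moreover have "omega_limit T \<phi> {x} \<subseteq> M"
    using omega_limit_morse[OF M] complete_orbit_zero[OF \<gamma>] by simp
  ultimately show thesis using that[OF M(1) M(1) order_refl[OF M(1)]] by blast
qed

lemma orbit_order:
  assumes \<gamma>: "complete_orbit T X \<phi> x \<gamma>" and "M \<in> MM" "M' \<in> MM"
    and "omega_limit T \<phi> {x} \<subseteq> M" "alpha_limit T \<gamma> \<subseteq> M'"
  shows "(M, M') \<in> r"
proof -
  have x: "x \<in> X" using complete_orbit_in_space[OF \<gamma> zero_time] complete_orbit_zero[OF \<gamma>] by simp
  obtain N N' where N: "N \<in> MM" "N' \<in> MM" "(N, N') \<in> r" "omega_limit T \<phi> {x} \<subseteq> N" "alpha_limit T \<gamma> \<subseteq> N'"
    using orbit_ends[OF \<gamma>] .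
  have "M = N" by (rule morse_unique_subset[OF assms(2) N(1) assms(4) N(4) omega_limit_nonempty[OF x]])
  moreover have "M' = N'"
    by (rule morse_unique_subset[OF assms(3) N(2) assms(5) N(5) alpha_limit_nonempty[OF \<gamma>]])
  ultimately show ?thesis using N(3) by simp
qed

lemma orbit_order_strict:
  assumes \<gamma>: "complete_orbit T X \<phi> x \<gamma>" and "M \<in> MM" "M' \<in> MM" "x \<notin> \<Union>MM"
    and "omega_limit T \<phi> {x} \<subseteq> M" "alpha_limit T \<gamma> \<subseteq> M'"
  shows "M \<noteq> M'"
proof -
  have x: "x \<in> X" using complete_orbit_in_space[OF \<gamma> zero_time] complete_orbit_zero[OF \<gamma>] by simp
  obtain N N' where N: "N \<in> MM" "N' \<in> MM" "N \<noteq> N'" "omega_limit T \<phi> {x} \<subseteq> N" "alpha_limit T \<gamma> \<subseteq> N'"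
    using connecting[OF \<gamma> assms(4)] by metis
  have "M = N" by (rule morse_unique_subset[OF assms(2) N(1) assms(5) N(4) omega_limit_nonempty[OF x]])
  moreover have "M' = N'"
    by (rule morse_unique_subset[OF assms(3) N(2) assms(6) N(5) alpha_limit_nonempty[OF \<gamma>]])
  ultimately show ?thesis using N(3) by simp
qed

definition downset :: "'a set set \<Rightarrow> bool"
  where "downset \<alpha> \<longleftrightarrow> \<alpha> \<subseteq> MM \<and> (\<forall>p\<in>\<alpha>. \<forall>q\<in>MM. (q, p) \<in> r \<longrightarrow> q \<in> \<alpha>)"

lemma downsetD: "downset \<alpha> \<Longrightarrow> p \<in> \<alpha> \<Longrightarrow> (q, p) \<in> r \<Longrightarrow> q \<in> \<alpha>"
  using order_carrier unfolding downset_def by blast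

lemma downset_subset: "downset \<alpha> \<Longrightarrow> \<alpha> \<subseteq> MM"
  unfolding downset_def by blast

lemma in_nuE:
  assumes "downset \<alpha>" "x \<in> nu T X \<phi> \<alpha>"
  obtains M \<gamma> where "M \<in> \<alpha>" "M \<in> MM" "complete_orbit T X \<phi> x \<gamma>" "alpha_limit T \<gamma> \<subseteq> M"
proof -
  obtain M where M: "M \<in> \<alpha>" "x \<in> unstable_set T X \<phi> M" using assms(2) unfolding nu_def by blast
  moreover have "M \<in> MM" using M(1) downset_subset[OF assms(1)] by blast
  ultimately show thesis using that unfolding unstable_set_iff by metis
qed

lemma in_nuI:
  assumes "M \<in> \<alpha>" "complete_orbit T X \<phi> x \<gamma>" "alpha_limit T \<gamma> \<subseteq> M"
  shows "x \<in> nu T X \<phi> \<alpha>"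
proof -
  have "x \<in> unstable_set T X \<phi> M" unfolding unstable_set_iff using assms(2,3) by (intro exI conjI)
  then show ?thesis unfolding nu_def using assms(1) by (rule UN_I[rotated])
qed

text \<open>A point of \<open>M\<close> has its omega-limit set in \<open>M\<close>, so an orbit
  reaching it from a member of \<open>\<alpha>\<close> shows \<open>M\<close> to be below that
  member.\<close>

lemma morse_meets_nu:
  assumes "downset \<alpha>" "M \<in> MM" "M \<inter> nu T X \<phi> \<alpha> \<noteq> {}"
  shows "M \<in> \<alpha>"
proof -
  obtain x where x: "x \<in> M" "x \<in> nu T X \<phi> \<alpha>" using assms(3) by blast
  obtain M' \<gamma> where \<gamma>: "M' \<in> \<alpha>" "M' \<in> MM" "complete_orbit T X \<phi> x \<gamma>" "alpha_limit T \<gamma> \<subseteq> M'"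
    using in_nuE[OF assms(1) x(2)] .
  have "(M, M') \<in> r" by (rule orbit_order[OF \<gamma>(3) assms(2) \<gamma>(2) omega_limit_morse[OF assms(2) x(1)] \<gamma>(4)])
  then show ?thesis by (rule downsetD[OF assms(1) \<gamma>(1)])
qed

lemma morse_subset_nu:
  assumes "M \<in> \<alpha>" "M \<in> MM"
  shows "M \<subseteq> nu T X \<phi> \<alpha>"
proof
  fix x assume "x \<in> M"
  then obtain \<gamma> where \<gamma>: "complete_orbit T X \<phi> x \<gamma>" "\<And>t. t \<in> T \<Longrightarrow> \<gamma> t \<in> M"
    using complete_orbit_in_invariant[OF morse_invariant[OF assms(2)]] by metis
  show "x \<in> nu T X \<phi> \<alpha>"
    by (rule in_nuI[OF assms(1) \<gamma>(1) alpha_limit_subset[OF \<gamma>(2) morse_closed[OF assms(2)]]])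
qed

lemma orbit_in_nu:
  assumes "M \<in> \<alpha>" "complete_orbit T X \<phi> x \<gamma>" "alpha_limit T \<gamma> \<subseteq> M" "t \<in> T"
  shows "\<gamma> t \<in> nu T X \<phi> \<alpha>"
  by (rule in_nuI[OF assms(1) complete_orbit_shift[OF assms(2,4)]])
    (simp add: alpha_limit_shift assms(3,4))

lemma nu_invariant:
  assumes \<alpha>: "downset \<alpha>"
  shows "invariant T X \<phi> (nu T X \<phi> \<alpha>)"
  unfolding invariant_def
proof (intro conjI ballI equalityI)
  show "nu T X \<phi> \<alpha> \<subseteq> X" unfolding nu_def unstable_set_def by blast
  fix t assume t: "t \<in> nonneg_times T"
  show "\<phi> t ` nu T X \<phi> \<alpha> \<subseteq> nu T X \<phi> \<alpha>"
  proof
    fix y assume "y \<in> \<phi> t ` nu T X \<phi> \<alpha>"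
    then obtain x where x: "x \<in> nu T X \<phi> \<alpha>" "y = \<phi> t x" by blast
    obtain M \<gamma> where \<gamma>: "M \<in> \<alpha>" "M \<in> MM" "complete_orbit T X \<phi> x \<gamma>" "alpha_limit T \<gamma> \<subseteq> M"
      using in_nuE[OF \<alpha> x(1)] .
    have "y = \<gamma> t"
      using complete_orbit_flow[OF \<gamma>(3) zero_time t] complete_orbit_zero[OF \<gamma>(3)] x(2) by simp
    then show "y \<in> nu T X \<phi> \<alpha>" using orbit_in_nu[OF \<gamma>(1,3,4) nonneg_time_in[OF t]] by simp
  qed
  show "nu T X \<phi> \<alpha> \<subseteq> \<phi> t ` nu T X \<phi> \<alpha>"
  proof
    fix x assume x: "x \<in> nu T X \<phi> \<alpha>"
    obtain M \<gamma> where \<gamma>: "M \<in> \<alpha>" "M \<in> MM" "complete_orbit T X \<phi> x \<gamma>" "alpha_limit T \<gamma> \<subseteq> M"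
      using in_nuE[OF \<alpha> x] .
    have mt: "- t \<in> T" using minus_time[OF nonneg_time_in[OF t]] .
    have "x = \<phi> t (\<gamma> (- t))"
      using complete_orbit_flow[OF \<gamma>(3) mt t] complete_orbit_zero[OF \<gamma>(3)] by simp
    then show "x \<in> \<phi> t ` nu T X \<phi> \<alpha>" using orbit_in_nu[OF \<gamma>(1,3,4) mt] by blast
  qed
qed

text \<open>
  If \<open>K\<close> is not contained in \<open>\<nu>(\<alpha>)\<close>, apply the hypothesis to a maximal Morse set \<open>M\<close> outside \<open>\<alpha>\<close>
  that meets \<open>K\<close>: the orbit of \<open>y\<close> in \<open>K\<close> emanates from a larger Morse set, which also meets \<open>K\<close>
  and, \<open>\<alpha>\<close> being a down-set, is not in \<open>\<alpha>\<close> either.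
\<close>

lemma subset_nu_criterion:
  assumes \<alpha>: "downset \<alpha>" and K: "closed K" "invariant T X \<phi> K"
    and witness: "\<And>M. M \<in> MM \<Longrightarrow> M \<notin> \<alpha> \<Longrightarrow> K \<inter> M \<noteq> {} \<Longrightarrow>
      \<exists>y\<in>K. y \<notin> \<Union>MM \<and> omega_limit T \<phi> {y} \<subseteq> M"
  shows "K \<subseteq> nu T X \<phi> \<alpha>"
proof -
  define \<B> where "\<B> = {M \<in> MM. M \<notin> \<alpha> \<and> K \<inter> M \<noteq> {}}"
  have "\<B> = {}"
  proof (rule ccontr)
    assume "\<B> \<noteq> {}"
    then obtain M where M: "M \<in> \<B>" and max: "\<And>N. N \<in> \<B> \<Longrightarrow> (M, N) \<in> r \<Longrightarrow> N = M"
      using maximal_exists[of \<B>] unfolding \<B>_def by (metis (no_types, lifting) mem_Collect_eq subsetI)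
    have M': "M \<in> MM" "M \<notin> \<alpha>" using M unfolding \<B>_def by auto
    obtain y where y: "y \<in> K" "y \<notin> \<Union>MM" "omega_limit T \<phi> {y} \<subseteq> M"
      using witness M unfolding \<B>_def by blast
    obtain \<gamma> where \<gamma>: "complete_orbit T X \<phi> y \<gamma>" "\<And>t. t \<in> T \<Longrightarrow> \<gamma> t \<in> K"
      using complete_orbit_in_invariant[OF K(2) y(1)] by blast
    obtain N N' where N: "N' \<in> MM" "alpha_limit T \<gamma> \<subseteq> N'"
      using orbit_ends[OF \<gamma>(1)] by metis
    have le: "(M, N') \<in> r" by (rule orbit_order[OF \<gamma>(1) M'(1) N(1) y(3) N(2)])
    have ne: "M \<noteq> N'" by (rule orbit_order_strict[OF \<gamma>(1) M'(1) N(1) y(2,3) N(2)])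
    have "alpha_limit T \<gamma> \<subseteq> K" by (rule alpha_limit_subset[OF \<gamma>(2) K(1)])
    then have "K \<inter> N' \<noteq> {}" using N(2) alpha_limit_nonempty[OF \<gamma>(1)] by blast
    moreover have "N' \<notin> \<alpha>" using downsetD[OF \<alpha> _ le] M'(2) by blast
    ultimately have "N' \<in> \<B>" using N(1) unfolding \<B>_def by blast
    then show False using max[OF _ le] ne by blast
  qed
  show ?thesis
  proof
    fix x assume "x \<in> K"
    then obtain \<gamma> where \<gamma>: "complete_orbit T X \<phi> x \<gamma>" "\<And>t. t \<in> T \<Longrightarrow> \<gamma> t \<in> K"
      using complete_orbit_in_invariant[OF K(2)] by metis
    obtain N' where N: "N' \<in> MM" "alpha_limit T \<gamma> \<subseteq> N'"
      using orbit_ends[OF \<gamma>(1)] by metis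
    have "alpha_limit T \<gamma> \<subseteq> K" by (rule alpha_limit_subset[OF \<gamma>(2) K(1)])
    then have "K \<inter> N' \<noteq> {}" using N(2) alpha_limit_nonempty[OF \<gamma>(1)] by blast
    then have "N' \<in> \<alpha>" using \<open>\<B> = {}\<close> N(1) unfolding \<B>_def by blast
    then show "x \<in> nu T X \<phi> \<alpha>" using \<gamma>(1) N(2) by (rule in_nuI)
  qed
qed

text \<open>
  \<open>b n\<close> is a finite backward orbit from a point near \<open>M\<close> that leaves the \<open>e\<close>-neighborhood of \<open>M\<close>.
  The limit \<open>y\<close> of the first exit points converges to \<open>M\<close> in forward time: if the exit times are
  bounded along a subsequence, then \<open>y\<close> is mapped into \<open>M\<close>, and otherwise the forward orbit of \<open>y\<close>
  stays in the neighborhood.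
\<close>

lemma exit_point:
  fixes b :: "nat \<Rightarrow> nat \<Rightarrow> 'a" and L :: "nat \<Rightarrow> nat"
  assumes M: "M \<in> MM" and e: "0 < e"
    and sep: "\<And>q. q \<in> \<Union>(MM - {M}) \<Longrightarrow> e < infdist q M"
    and bX: "\<And>n j. j \<le> L n \<Longrightarrow> b n j \<in> X"
    and step: "\<And>n j. j < L n \<Longrightarrow> \<phi> 1 (b n (Suc j)) = b n j"
    and near: "(\<lambda>n. infdist (b n 0) M) \<longlonglongrightarrow> 0"
    and out: "\<And>n. e < infdist (b n (L n)) M"
  obtains h j y where "strict_mono (h :: nat \<Rightarrow> nat)" "\<And>n. j n \<le> L (h n)" "(\<lambda>n. b (h n) (j n)) \<longlonglongrightarrow> y"
    "y \<in> X" "y \<notin> \<Union>MM" "omega_limit T \<phi> {y} \<subseteq> M"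
proof -
  define k where "k n = (LEAST j. e < infdist (b n j) M)" for n
  have kL: "k n \<le> L n" for n unfolding k_def by (rule Least_le) (rule out)
  have kout: "e < infdist (b n (k n)) M" for n unfolding k_def by (rule LeastI) (rule out)
  have kin: "infdist (b n j) M \<le> e" if "j < k n" for n j
    using not_less_Least[of j "\<lambda>j. e < infdist (b n j) M"] that unfolding k_def by simp
  have b_flow: "\<phi> (real i) (b n (k n)) = b n (k n - i)" if "i \<le> k n" for i n
    using that
  proof (induction i)
    case 0
    then show ?case using at_zero[OF bX[OF kL]] by simp
  next
    case (Suc i)
    have "\<phi> (real (Suc i)) (b n (k n)) = \<phi> 1 (\<phi> (real i) (b n (k n)))"
      using semigroup[OF nat_nonneg_time(1)[of i] nat_nonneg_time(3) bX[OF kL]] by simp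
    also have "\<dots> = \<phi> 1 (b n (Suc (k n - Suc i)))" using Suc by (simp add: Suc_diff_Suc)
    also have "\<dots> = b n (k n - Suc i)" by (rule step) (use Suc.prems kL[of n] in linarith)
    finally show ?case .
  qed
  obtain y h where y: "y \<in> X" and h: "strict_mono (h :: nat \<Rightarrow> nat)"
      and lim: "(\<lambda>n. b (h n) (k (h n))) \<longlonglongrightarrow> y"
    using convergent_subseq[of "\<lambda>n. b n (k n)"] bX[OF kL] by blast
  have "e \<le> infdist y M"
    by (rule tendsto_lowerbound[OF tendsto_infdist[OF lim]])
      (auto intro: always_eventually less_imp_le kout)
  have lim_flow: "(\<lambda>n. infdist (\<phi> (real i) (b (h n) (k (h n)))) M) \<longlonglongrightarrow> infdist (\<phi> (real i) y) M" for i
    by (rule tendsto_infdist[OF flow_tendsto_const[OF lim y]]) (simp_all add: bX[OF kL])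
  have flowX: "\<phi> (real i) y \<in> X" for i by (rule maps_to[OF nat_nonneg_time(1) y])
  have \<omega>: "omega_limit T \<phi> {y} \<subseteq> M"
  proof (cases "\<exists>i. \<exists>\<^sub>F n in sequentially. k (h n) = i")
    case True
    then obtain i where i: "\<exists>\<^sub>F n in sequentially. k (h n) = i" ..
    have "infdist (\<phi> (real i) y) M = 0"
    proof (rule tendsto_eq_0_if_frequently_eq[OF lim_flow])
      show "(\<lambda>n. infdist (b (h n) 0) M) \<longlonglongrightarrow> 0"
        using LIMSEQ_subseq_LIMSEQ[OF near h] by (simp add: o_def)
      show "\<exists>\<^sub>F n in sequentially. infdist (\<phi> (real i) (b (h n) (k (h n)))) M = infdist (b (h n) 0) M"
        using i by (rule frequently_elim1) (use b_flow in fastforce)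
    qed
    then have "\<phi> (real i) y \<in> M"
      using in_closed_iff_infdist_zero[OF morse_closed[OF M] morse_nonempty[OF M]] by blast
    then show ?thesis
      using omega_limit_morse[OF M, of "\<phi> (real i) y"] omega_limit_flow[OF _ nat_nonneg_time(1)[of i], of "{y}"] y by simp
  next
    case False
    \<comment> \<open>Time 0 is left out, \<open>y\<close> itself being at distance at least
      \<open>e\<close> from \<open>M\<close>.\<close>
    have stays: "infdist (\<phi> (real (Suc i)) y) M \<le> e" for i
    proof (rule tendsto_upperbound[OF lim_flow])
      have "\<forall>\<^sub>F n in sequentially. \<forall>j\<in>{..i}. k (h n) \<noteq> j"
        using False by (intro eventually_ball_finite) (auto simp: not_frequently)
      then show "\<forall>\<^sub>F n in sequentially. infdist (\<phi> (real (Suc i)) (b (h n) (k (h n)))) M \<le> e"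
      proof eventually_elim
        case (elim n)
        then have "Suc i \<le> k (h n)" by (cases "k (h n) \<le> i") auto
        then show ?case using b_flow[of "Suc i" "h n"] kin[of "k (h n) - Suc i" "h n"] by simp
      qed
    qed simp
    have "\<phi> s ` {y} \<subseteq> X" if "s \<in> nonneg_times T" for s using maps_to[OF that y] by simp
    moreover have "real n \<le> real (Suc n)" for n by simp
    \<comment> \<open>One limit point along integer times is enough: \<open>omega_in\<close> puts
      all of \<open>\<omega>(y)\<close> in a single Morse set, and within distance \<open>e\<close>
      of \<open>M\<close> the point \<open>w\<close> can belong to no other one.\<close>
    ultimately obtain w l where w: "w \<in> tail_limit T (\<lambda>s. \<phi> s ` {y})"
        "(\<lambda>n. \<phi> (real (Suc (l n))) y) \<longlonglongrightarrow> w"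
      by (rule tail_limit_convergent_subseq[where G = "\<lambda>s. \<phi> s ` {y}" and s = "\<lambda>n. real (Suc n)"
            and z = "\<lambda>n. \<phi> (real (Suc n)) y", OF _ nat_nonneg_time(1)]) auto
    have "infdist w M \<le> e"
      by (rule tendsto_upperbound[OF tendsto_infdist[OF w(2)]]) (use stays in \<open>auto intro!: always_eventually\<close>)
    obtain N where N: "N \<in> MM" "omega_limit T \<phi> {y} \<subseteq> N" using omega_in[OF y] by blast
    have "w \<in> N" using w(1) N(2) unfolding omega_limit_eq_tail_limit by blast
    then have "N = M" using sep[of w] \<open>infdist w M \<le> e\<close> N(1) by force
    with N(2) show ?thesis by simp
  qed
  have "y \<notin> \<Union>MM"
  proof
    assume "y \<in> \<Union>MM"
    then obtain N where N: "N \<in> MM" "y \<in> N" by blast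
    have "M = N"
      by (rule morse_unique_subset[OF M N(1) \<omega> omega_limit_morse[OF N] omega_limit_nonempty[OF y]])
    then show False using N(2) \<open>e \<le> infdist y M\<close> e by simp
  qed
  show thesis by (rule that[OF h kL lim y \<open>y \<notin> \<Union>MM\<close> \<omega>])
qed

end

section \<open>Shrinking relative neighborhoods\<close>

context compact_dynamical_system
begin

text \<open>The condition asks for a witness in \<open>A\<close> instead of bounding
  \<open>infdist\<close>, so that the neighborhood of \<open>{}\<close> is empty, whereas
  \<open>infdist\<close> to \<open>{}\<close> is 0. This case occurs for the empty down-set.\<close>

definition relative_nbhd :: "'a set \<Rightarrow> nat \<Rightarrow> 'a set"
  where "relative_nbhd A n = {x \<in> X. \<exists>a\<in>A. dist a x < inverse (real (Suc n))}"

lemma relative_nbhd_subset_space: "relative_nbhd A n \<subseteq> X"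
  unfolding relative_nbhd_def by blast

lemma subset_relative_nbhd: "A \<subseteq> X \<Longrightarrow> A \<subseteq> relative_nbhd A n"
  unfolding relative_nbhd_def by force

lemma relative_nbhd_antimono:
  assumes "m \<le> n"
  shows "relative_nbhd A n \<subseteq> relative_nbhd A m"
proof -
  have "inverse (real (Suc n)) \<le> inverse (real (Suc m))"
    using assms by (intro le_imp_inverse_le) auto
  then have "d < inverse (real (Suc m))" if "d < inverse (real (Suc n))" for d
    using that by linarith
  then show ?thesis unfolding relative_nbhd_def by blast
qed

lemma openin_relative_nbhd: "openin (top_of_set X) (relative_nbhd A n)"
proof -
  have "relative_nbhd A n = X \<inter> (\<Union>a\<in>A. ball a (inverse (real (Suc n))))"
    unfolding relative_nbhd_def by auto
  then show ?thesis by (simp add: openin_open_Int open_UN)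
qed

text \<open>Otherwise points approaching \<open>A\<close> reach \<open>D\<close> at times from a
  bounded interval. A limit of these points and times gives \<open>x \<in> A\<close> with
  \<open>\<phi> t x \<in> D\<close>, against forward invariance. The lemma serves to force exit
  times to infinity.\<close>

lemma relative_nbhd_avoids:
  assumes A: "closed A" "A \<subseteq> X" "\<And>t x. t \<in> nonneg_times T \<Longrightarrow> x \<in> A \<Longrightarrow> \<phi> t x \<in> A"
    and D: "closed D" "D \<inter> A = {}"
  obtains n where "\<And>u \<tau>. u \<in> relative_nbhd A n \<Longrightarrow> \<tau> \<in> nonneg_times T \<Longrightarrow> \<tau> \<le> c \<Longrightarrow> \<phi> \<tau> u \<notin> D"
proof (rule ccontr)
  assume "\<not> thesis"
  then have "\<forall>n. \<exists>u \<tau>. u \<in> relative_nbhd A n \<and> \<tau> \<in> nonneg_times T \<and> \<tau> \<le> c \<and> \<phi> \<tau> u \<in> D"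
    using that by metis
  then obtain u \<tau> where u\<tau>: "\<And>n. u n \<in> relative_nbhd A n" "\<And>n. \<tau> n \<in> nonneg_times T"
      "\<And>n. \<tau> n \<le> c" "\<And>n. \<phi> (\<tau> n) (u n) \<in> D"
    by metis
  have "\<forall>n. \<exists>a. a \<in> A \<and> dist a (u n) < inverse (real (Suc n))"
    using u\<tau>(1) unfolding relative_nbhd_def by blast
  then obtain a where a: "\<And>n. a n \<in> A" "\<And>n. dist (a n) (u n) < inverse (real (Suc n))"
    using choice[of "\<lambda>n a. a \<in> A \<and> dist a (u n) < inverse (real (Suc n))"] by blast
  have uX: "u n \<in> X" for n using u\<tau>(1) relative_nbhd_subset_space by blast
  have "compact (T \<inter> {0..c})"
    using closed_time compact_Icc by (rule closed_Int_compact)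
  moreover have "\<forall>n. \<tau> n \<in> T \<inter> {0..c}" using u\<tau>(2,3) by (auto simp: nonneg_times_def)
  ultimately obtain t k where k: "t \<in> T \<inter> {0..c}" "strict_mono (k :: nat \<Rightarrow> nat)" "(\<tau> \<circ> k) \<longlonglongrightarrow> t"
    unfolding compact_def by meson
  obtain x l where l: "x \<in> X" "strict_mono (l :: nat \<Rightarrow> nat)" "(\<lambda>n. u (k (l n))) \<longlonglongrightarrow> x"
    using convergent_subseq[of "\<lambda>n. u (k n)"] uX by blast
  have kl: "strict_mono (\<lambda>n. k (l n))"
    using strict_mono_compose[OF k(2) l(2)] by (simp add: o_def)
  have "(\<lambda>n. dist (a n) (u n)) \<longlonglongrightarrow> 0"
    by (rule Lim_null_comparison[OF _ LIMSEQ_inverse_real_of_nat])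
      (use less_imp_le[OF a(2)] in \<open>auto intro!: always_eventually\<close>)
  from LIMSEQ_subseq_LIMSEQ[OF this kl]
  have "(\<lambda>n. dist (a (k (l n))) (u (k (l n)))) \<longlonglongrightarrow> 0" by (simp add: o_def)
  from tendsto_add[OF this iffD1[OF tendsto_dist_iff l(3)]]
  have "(\<lambda>n. dist (a (k (l n))) (u (k (l n))) + dist (u (k (l n))) x) \<longlonglongrightarrow> 0" by simp
  then have "(\<lambda>n. dist (a (k (l n))) x) \<longlonglongrightarrow> 0"
    by (rule Lim_null_comparison[rotated]) (simp add: dist_triangle)
  then have "(\<lambda>n. a (k (l n))) \<longlonglongrightarrow> x" by (rule iffD2[OF tendsto_dist_iff])
  then have xA: "x \<in> A" using closed_sequentially[OF A(1), of "\<lambda>n. a (k (l n))"] a(1) by blast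
  have t: "t \<in> nonneg_times T" using k(1) by (simp add: nonneg_times_def)
  have "(\<lambda>n. \<tau> (k (l n))) \<longlonglongrightarrow> t"
    using LIMSEQ_subseq_LIMSEQ[OF k(3) l(2)] by (simp add: o_def)
  then have "(\<lambda>n. \<phi> (\<tau> (k (l n))) (u (k (l n)))) \<longlonglongrightarrow> \<phi> t x"
    by (intro flow_tendsto l(3,1) uX t u\<tau>(2))
  then have "\<phi> t x \<in> D"
    using closed_sequentially[OF D(1), of "\<lambda>n. \<phi> (\<tau> (k (l n))) (u (k (l n)))"] u\<tau>(4) by blast
  moreover have "\<phi> t x \<in> A" by (rule A(3)[OF t xA])
  ultimately show False using D(2) by blast
qed

end

section \<open>Images of down-sets are attractors\<close>

context morse_decomposition
begin

lemma compact_Union_morse: "\<B> \<subseteq> MM \<Longrightarrow> compact (\<Union>\<B>)"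
  using finite_subset[OF _ finite_MM] morse_compact by (intro compact_Union) auto

lemma other_morse_disjoint: "M \<in> MM \<Longrightarrow> \<Union>(MM - {M}) \<inter> M = {}"
  using morse_unique by blast

lemma nu_closed:
  assumes \<alpha>: "downset \<alpha>"
  shows "closed (nu T X \<phi> \<alpha>)"
proof -
  let ?K = "closure (nu T X \<phi> \<alpha>)"
  have "?K \<subseteq> nu T X \<phi> \<alpha>"
  proof (rule subset_nu_criterion[OF \<alpha> closed_closure invariant_closure[OF nu_invariant[OF \<alpha>]]])
    fix M assume M: "M \<in> MM" "M \<notin> \<alpha>" and "?K \<inter> M \<noteq> {}"
    then obtain p where p: "p \<in> ?K" "p \<in> M" by blast
    obtain x where x: "\<And>n. x n \<in> nu T X \<phi> \<alpha>" "x \<longlonglongrightarrow> p"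
      using p(1) unfolding closure_sequential by blast
    obtain e where e: "0 < e" "\<And>q. q \<in> \<Union>(MM - {M}) \<Longrightarrow> e < infdist q M"
      using compact_infdist_separated[OF morse_closed[OF M(1)] morse_nonempty[OF M(1)]
          compact_Union_morse[OF Diff_subset] other_morse_disjoint[OF M(1)]] by metis
    \<comment> \<open>A backward orbit of \<open>x n\<close> comes from a Morse set in
      \<open>\<alpha>\<close>, thus from another one than \<open>M\<close>, and is farther than
      \<open>e\<close> from \<open>M\<close> at some integer time \<open>- l\<close>.\<close>
    have "\<exists>\<gamma> N l. N \<in> \<alpha> \<and> complete_orbit T X \<phi> (x n) \<gamma> \<and> alpha_limit T \<gamma> \<subseteq> N \<and>
        e < infdist (\<gamma> (- real l)) M" for n
    proof -
      obtain N \<gamma> where \<gamma>: "N \<in> \<alpha>" "N \<in> MM" "complete_orbit T X \<phi> (x n) \<gamma>" "alpha_limit T \<gamma> \<subseteq> N"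
        using in_nuE[OF \<alpha> x(1)[of n]] .
      have "N \<noteq> M" using \<gamma>(1) M(2) by blast
      then have "alpha_limit T \<gamma> \<subseteq> {q. e < infdist q M}" using \<gamma>(2,4) e(2) by blast
      moreover have "open {q. e < infdist q M}"
        by (intro open_Collect_less continuous_intros)
      moreover have "{\<gamma> (- s)} \<subseteq> X" if "s \<in> nonneg_times T" for s
        using complete_orbit_in_space[OF \<gamma>(3) minus_time[OF nonneg_time_in[OF that]]] by simp
      ultimately obtain t where t: "\<And>s. s \<in> nonneg_times T \<Longrightarrow> t \<le> s \<Longrightarrow> {\<gamma> (- s)} \<subseteq> {q. e < infdist q M}"
        unfolding alpha_limit_tail using tail_limit_attracts[of "\<lambda>s. {\<gamma> (- s)}"] by metis
      obtain l where "t \<le> real l" using real_arch_simple by blast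
      from t[OF nat_nonneg_time(1) this] have "e < infdist (\<gamma> (- real l)) M" by simp
      with \<gamma> show ?thesis by blast
    qed
    then obtain \<gamma> N L where \<gamma>: "\<And>n. N n \<in> \<alpha>" "\<And>n. complete_orbit T X \<phi> (x n) (\<gamma> n)"
        "\<And>n. alpha_limit T (\<gamma> n) \<subseteq> N n" "\<And>n. e < infdist (\<gamma> n (- real (L n))) M"
      by metis
    have time: "- real j \<in> T" for j by (rule minus_time[OF nat_time])
    have near: "(\<lambda>n. infdist (\<gamma> n (- real 0)) M) \<longlonglongrightarrow> 0"
      using tendsto_infdist[OF x(2), of M] p(2) complete_orbit_zero[OF \<gamma>(2)] by simp
    have step: "\<phi> 1 (\<gamma> n (- real (Suc j))) = \<gamma> n (- real j)" for n j
      using complete_orbit_flow[OF \<gamma>(2) time nat_nonneg_time(3), of n "Suc j"] by simp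
    obtain h j y where y: "(\<lambda>n. \<gamma> (h n) (- real (j n))) \<longlonglongrightarrow> y" "y \<notin> \<Union>MM" "omega_limit T \<phi> {y} \<subseteq> M"
      by (rule exit_point[where b = "\<lambda>n j. \<gamma> n (- real j)" and L = L, OF M(1) e
            complete_orbit_in_space[OF \<gamma>(2) time] step near \<gamma>(4)])
    have "\<gamma> n (- real j) \<in> ?K" for n j
      using orbit_in_nu[OF \<gamma>(1-3) time] closure_subset by blast
    then have "y \<in> ?K" using closed_sequentially[OF closed_closure _ y(1)] by blast
    with y(2,3) show "\<exists>y\<in>?K. y \<notin> \<Union>MM \<and> omega_limit T \<phi> {y} \<subseteq> M" by blast
  qed
  then show ?thesis by (metis closure_subset closed_closure subset_antisym)
qed

text \<open>Here the backward segments are forward orbits read backwards, leading from points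
  \<open>u n\<close> close to \<open>A\<close> to points close to \<open>M\<close>. The set
  \<open>M\<close> has to be met for all \<open>n\<close> because the \<open>u n\<close> must
  approach \<open>A\<close>, although the conclusion concerns one \<open>m\<close>.\<close>

lemma nu_attractor_witness:
  fixes \<alpha> :: "'a set set"
  defines "A \<equiv> nu T X \<phi> \<alpha>"
  assumes \<alpha>: "downset \<alpha>" and M: "M \<in> MM" "M \<notin> \<alpha>"
    and meets: "\<And>n. omega_limit T \<phi> (relative_nbhd A n) \<inter> M \<noteq> {}"
  shows "\<exists>y\<in>omega_limit T \<phi> (relative_nbhd A m). y \<notin> \<Union>MM \<and> omega_limit T \<phi> {y} \<subseteq> M"
proof -
  have Acl: "closed A" and Ainv: "invariant T X \<phi> A"
    unfolding A_def by (rule nu_closed[OF \<alpha>] nu_invariant[OF \<alpha>])+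
  have AX: "A \<subseteq> X" by (rule invariant_subset_space[OF Ainv])
  have AM: "A \<inter> M = {}" using morse_meets_nu[OF \<alpha> M(1)] M(2) unfolding A_def by blast
  have "compact (A \<union> \<Union>(MM - {M}))"
    using compact_subspace[OF Acl AX] compact_Union_morse[OF Diff_subset] by (rule compact_Un)
  moreover have "(A \<union> \<Union>(MM - {M})) \<inter> M = {}" using AM other_morse_disjoint[OF M(1)] by blast
  ultimately obtain e where e: "0 < e" "\<And>q. q \<in> A \<union> \<Union>(MM - {M}) \<Longrightarrow> e < infdist q M"
    using compact_infdist_separated[OF morse_closed[OF M(1)] morse_nonempty[OF M(1)]] by metis
  have avoid: "\<exists>n. \<forall>u \<tau>. u \<in> relative_nbhd A n \<longrightarrow> \<tau> \<in> nonneg_times T \<longrightarrow> \<tau> \<le> c \<longrightarrow> \<phi> \<tau> u \<notin> D"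
    if "closed D" "D \<inter> A = {}" for D c
    using relative_nbhd_avoids[OF Acl AX _ that, of c] invariant_forward[OF Ainv] by metis
  have "closed {q. infdist q M \<le> e}" by (intro closed_Collect_le continuous_intros)
  moreover have "{q. infdist q M \<le> e} \<inter> A = {}" using e(2) by fastforce
  \<comment> \<open>The sampled segment ends at time \<open>s n - real (L n)\<close>, which lies
    between 0 and 1 and need not be 0. Starting in this neighborhood guarantees that even this last
    sample is farther than \<open>e\<close> from \<open>M\<close>.\<close>
  ultimately obtain n0 where n0: "\<And>u \<tau>. u \<in> relative_nbhd A n0 \<Longrightarrow> \<tau> \<in> nonneg_times T \<Longrightarrow> \<tau> \<le> 1 \<Longrightarrow>
      \<phi> \<tau> u \<notin> {q. infdist q M \<le> e}"
    using avoid[of "{q. infdist q M \<le> e}" 1] by blast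
  \<comment> \<open>The index \<open>n + n0\<close> makes the \<open>u n\<close> approach
    \<open>A\<close> and keeps all of them in the neighborhood just chosen.\<close>
  have "\<exists>u s p. u \<in> relative_nbhd A (n + n0) \<and> s \<in> nonneg_times T \<and> p \<in> M \<and>
      dist (\<phi> s u) p < inverse (real (Suc n))" for n
  proof -
    obtain p where p: "p \<in> tail_limit T (\<lambda>s. \<phi> s ` relative_nbhd A (n + n0))" "p \<in> M"
      using meets[of "n + n0"] unfolding omega_limit_eq_tail_limit by blast
    obtain s z where sz: "\<And>i. s i \<in> nonneg_times T" "\<And>i. z i \<in> \<phi> (s i) ` relative_nbhd A (n + n0)" "z \<longlonglongrightarrow> p"
      using tail_limitE[OF p(1)] by metis
    obtain i where "dist (z i) p < inverse (real (Suc n))"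
      using metric_LIMSEQ_D[OF sz(3), of "inverse (real (Suc n))"] by auto
    moreover obtain v where "v \<in> relative_nbhd A (n + n0)" "z i = \<phi> (s i) v" using sz(2) by blast
    ultimately show ?thesis using sz(1)[of i] p(2) by auto
  qed
  then obtain u s p where u: "\<And>n. u n \<in> relative_nbhd A (n + n0)" and s: "\<And>n. s n \<in> nonneg_times T"
      and p: "\<And>n. p n \<in> M" "\<And>n. dist (\<phi> (s n) (u n)) (p n) < inverse (real (Suc n))"
    by metis
  have uX: "u n \<in> X" for n using u relative_nbhd_subset_space by blast
  have un0: "u n \<in> relative_nbhd A n0" and un: "u n \<in> relative_nbhd A n" for n
    using u[of n] relative_nbhd_antimono[of n0 "n + n0" A] relative_nbhd_antimono[of n "n + n0" A] by auto
  define L where "L n = nat \<lfloor>s n\<rfloor>" for n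
  have s0: "s n \<in> T" "0 \<le> s n" for n using s[of n] by (auto simp: nonneg_times_def)
  have L: "real (L n) \<le> s n" "s n \<le> real (L n) + 1" for n
    unfolding L_def using s0(2)[of n] by linarith+
  have time: "s n - real j \<in> nonneg_times T" if "j \<le> L n" for n j
    using that L(1)[of n] s0(1)[of n] by (simp add: nonneg_times_def diff_time)
  have bX: "\<phi> (s n - real j) (u n) \<in> X" if "j \<le> L n" for n j
    by (rule maps_to[OF time[OF that] uX])
  have step: "\<phi> 1 (\<phi> (s n - real (Suc j)) (u n)) = \<phi> (s n - real j) (u n)" if "j < L n" for n j
    using semigroup[OF time[of "Suc j" n] nat_nonneg_time(3) uX] that by simp
  have near: "(\<lambda>n. infdist (\<phi> (s n - real 0) (u n)) M) \<longlonglongrightarrow> 0"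
  proof (rule Lim_null_comparison[OF _ LIMSEQ_inverse_real_of_nat], intro always_eventually allI)
    fix n
    show "norm (infdist (\<phi> (s n - real 0) (u n)) M) \<le> inverse (real (Suc n))"
      using infdist_le2[OF p(1)[of n] less_imp_le[OF p(2)[of n]]]
        infdist_nonneg[of "\<phi> (s n) (u n)" M] by simp
  qed
  have out: "e < infdist (\<phi> (s n - real (L n)) (u n)) M" for n
    using n0[OF un0[of n] time[OF order.refl, of n]] L(2)[of n] by force
  have sep: "e < infdist q M" if "q \<in> \<Union>(MM - {M})" for q using e(2) that by blast
  obtain h j y where h: "strict_mono (h :: nat \<Rightarrow> nat)" and jL: "\<And>n. j n \<le> L (h n)"
      and lim: "(\<lambda>n. \<phi> (s (h n) - real (j n)) (u (h n))) \<longlonglongrightarrow> y"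
      and y: "y \<in> X" "y \<notin> \<Union>MM" "omega_limit T \<phi> {y} \<subseteq> M"
  proof -
    show thesis
      by (rule exit_point[where b = "\<lambda>n j. \<phi> (s n - real j) (u n)" and L = L,
            OF M(1) e(1) sep bX step near out]) (assumption | rule that)+
  qed
  define \<tau> where "\<tau> n = s (h n) - real (j n)" for n
  have \<tau>: "\<tau> n \<in> nonneg_times T" for n unfolding \<tau>_def by (rule time[OF jL])
  have lim': "(\<lambda>n. \<phi> (\<tau> n) (u (h n))) \<longlonglongrightarrow> y" using lim unfolding \<tau>_def .
  have "y \<notin> A"
  proof
    assume "y \<in> A"
    then have "omega_limit T \<phi> {y} \<subseteq> A" by (rule omega_limit_point_subset[OF Acl Ainv])
    with y(3) AM omega_limit_nonempty[OF y(1)] show False by blast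
  qed
  then obtain \<delta> where "0 < \<delta>" "cball y \<delta> \<subseteq> - A"
    using open_contains_cball[of "- A"] open_Compl[OF Acl] by blast
  then have \<delta>: "0 < \<delta>" "cball y \<delta> \<inter> A = {}" by blast+
  have nbhd_eventually: "\<forall>\<^sub>F n in sequentially. u (h n) \<in> relative_nbhd A i" for i
    unfolding eventually_sequentially
  proof (intro exI allI impI)
    fix n assume "i \<le> n"
    then have "i \<le> h n" using seq_suble[OF h, of n] by linarith
    then show "u (h n) \<in> relative_nbhd A i" using un[of "h n"] relative_nbhd_antimono by blast
  qed
  \<comment> \<open>\<open>y\<close> is at positive distance from \<open>A\<close>, and points close
    to \<open>A\<close> reach the vicinity of \<open>y\<close> only after long times. This is what
    puts \<open>y\<close> in the omega-limit set.\<close>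
  have top: "filterlim \<tau> at_top sequentially"
    unfolding filterlim_at_top
  proof
    fix c
    obtain i where i: "\<And>u \<tau>. u \<in> relative_nbhd A i \<Longrightarrow> \<tau> \<in> nonneg_times T \<Longrightarrow> \<tau> \<le> c \<Longrightarrow> \<phi> \<tau> u \<notin> cball y \<delta>"
      using avoid[OF closed_cball \<delta>(2), of c] by blast
    have "\<forall>\<^sub>F n in sequentially. \<phi> (\<tau> n) (u (h n)) \<in> ball y \<delta>"
      using topological_tendstoD[OF lim' open_ball] \<delta>(1) by simp
    with nbhd_eventually[of i] show "\<forall>\<^sub>F n in sequentially. c \<le> \<tau> n"
    proof eventually_elim
      case (elim n)
      then have "\<phi> (\<tau> n) (u (h n)) \<in> cball y \<delta>" using ball_subset_cball by blast
      then show ?case using i[OF elim(1) \<tau>, of n] by linarith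
    qed
  qed
  have "\<forall>\<^sub>F n in sequentially. \<tau> n \<in> nonneg_times T \<and> \<phi> (\<tau> n) (u (h n)) \<in> \<phi> (\<tau> n) ` relative_nbhd A m"
    using nbhd_eventually[of m] by eventually_elim (simp add: \<tau>)
  then have "y \<in> omega_limit T \<phi> (relative_nbhd A m)"
    unfolding omega_limit_eq_tail_limit using lim' by (rule tail_limitI[OF top])
  with y(2,3) show ?thesis by blast
qed

text \<open>
  The set of Morse sets outside \<open>\<alpha>\<close> that meet \<open>\<omega>(U)\<close> is constant for all small neighborhoods \<open>U\<close>
  of \<open>\<nu>(\<alpha>)\<close>, as it decreases with \<open>U\<close>.
\<close>

lemma nu_attractor:
  assumes \<alpha>: "downset \<alpha>"
  shows "attractor T X \<phi> (nu T X \<phi> \<alpha>)"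
proof -
  let ?A = "nu T X \<phi> \<alpha>"
  let ?E = "\<lambda>n. omega_limit T \<phi> (relative_nbhd ?A n)"
  define \<B> where "\<B> n = {M \<in> MM. M \<notin> \<alpha> \<and> ?E n \<inter> M \<noteq> {}}" for n
  have AX: "?A \<subseteq> X" by (rule invariant_subset_space[OF nu_invariant[OF \<alpha>]])
  have fin: "finite (\<B> n)" for n unfolding \<B>_def using finite_MM by simp
  have anti: "\<B> n \<subseteq> \<B> m" if "m \<le> n" for m n
    using omega_limit_mono[OF relative_nbhd_antimono[OF that]] unfolding \<B>_def by blast
  obtain m where m: "\<And>n. card (\<B> m) \<le> card (\<B> n)"
    using ex_has_least_nat[of "\<lambda>_. True" 0 "\<lambda>n. card (\<B> n)"] by auto
  \<comment> \<open>\<open>nu_attractor_witness\<close> requires \<open>M\<close> to meet all the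
    sets \<open>?E n\<close>, while \<open>subset_nu_criterion\<close> provides this only for
    \<open>?E m\<close>.\<close>
  have stable: "\<B> m \<subseteq> \<B> n" for n
  proof (cases "m \<le> n")
    case True
    then have "\<B> n = \<B> m" using card_seteq[OF fin anti m] by blast
    then show ?thesis by simp
  next
    case False
    then show ?thesis using anti by simp
  qed
  have "?E m \<subseteq> ?A"
  proof (rule subset_nu_criterion[OF \<alpha> closed_omega_limit omega_limit_invariant[OF relative_nbhd_subset_space]])
    fix M assume M: "M \<in> MM" "M \<notin> \<alpha>" "?E m \<inter> M \<noteq> {}"
    then have "?E n \<inter> M \<noteq> {}" for n using stable[of n] unfolding \<B>_def by blast
    then show "\<exists>y\<in>?E m. y \<notin> \<Union>MM \<and> omega_limit T \<phi> {y} \<subseteq> M"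
      by (rule nu_attractor_witness[OF \<alpha> M(1,2)])
  qed
  moreover have "?A \<subseteq> ?E m"
    by (rule invariant_subset_omega_limit[OF nu_invariant[OF \<alpha>] subset_relative_nbhd[OF AX]])
  ultimately show ?thesis
    unfolding attractor_def using openin_relative_nbhd subset_relative_nbhd[OF AX]
    by (intro exI[of _ "relative_nbhd ?A m"]) auto
qed

section \<open>The lattice homomorphism \<open>\<nu>\<close>\<close>

lemma downsets_eq: "elems (Downsets (MM, r)) = Collect downset"
  by (auto simp: Downsets_def downset_def)

text \<open>A Morse set in \<open>\<alpha>\<close> is a nonempty part of
  \<open>\<nu>(\<alpha>)\<close>; once \<open>\<nu>(\<beta>)\<close> meets it, it belongs to
  \<open>\<beta>\<close>. From this order embedding injectivity and the join-irreducible elements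
  are read off.\<close>

lemma nu_subset_iff:
  assumes "downset \<alpha>" "downset \<beta>"
  shows "nu T X \<phi> \<alpha> \<subseteq> nu T X \<phi> \<beta> \<longleftrightarrow> \<alpha> \<subseteq> \<beta>"
proof
  assume le: "nu T X \<phi> \<alpha> \<subseteq> nu T X \<phi> \<beta>"
  show "\<alpha> \<subseteq> \<beta>"
  proof
    fix M assume M: "M \<in> \<alpha>"
    then have MM: "M \<in> MM" using downset_subset[OF assms(1)] by blast
    then have "M \<inter> nu T X \<phi> \<beta> \<noteq> {}" using morse_subset_nu[OF M MM] le morse_nonempty[OF MM] by blast
    then show "M \<in> \<beta>" by (rule morse_meets_nu[OF assms(2) MM])
  qed
qed (auto simp: nu_def)

lemma nu_inj: "inj_on (nu T X \<phi>) (Collect downset)"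
proof (rule inj_onI)
  fix \<alpha> \<beta> assume "\<alpha> \<in> Collect downset" "\<beta> \<in> Collect downset" "nu T X \<phi> \<alpha> = nu T X \<phi> \<beta>"
  then show "\<alpha> = \<beta>" using nu_subset_iff[of \<alpha> \<beta>] nu_subset_iff[of \<beta> \<alpha>] by simp
qed

lemma downset_Un: "downset \<alpha> \<Longrightarrow> downset \<beta> \<Longrightarrow> downset (\<alpha> \<union> \<beta>)"
  and downset_Int: "downset \<alpha> \<Longrightarrow> downset \<beta> \<Longrightarrow> downset (\<alpha> \<inter> \<beta>)"
  and downset_empty: "downset {}"
  and downset_MM: "downset MM"
  unfolding downset_def by auto

lemma nu_Un: "nu T X \<phi> (\<alpha> \<union> \<beta>) = nu T X \<phi> \<alpha> \<union> nu T X \<phi> \<beta>"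
  and nu_empty: "nu T X \<phi> {} = {}"
  unfolding nu_def by auto

text \<open>The plain intersection can be larger, as a point may have one backward orbit coming from
  \<open>\<alpha>\<close> and another from \<open>\<beta>\<close>. A single orbit inside both closed
  sets comes from a Morse set that meets both, hence from
  \<open>\<alpha> \<inter> \<beta>\<close>.\<close>

lemma nu_Int:
  assumes \<alpha>: "downset \<alpha>" and \<beta>: "downset \<beta>"
  shows "nu T X \<phi> (\<alpha> \<inter> \<beta>) = Inv T X \<phi> (nu T X \<phi> \<alpha> \<inter> nu T X \<phi> \<beta>)"
proof
  show "nu T X \<phi> (\<alpha> \<inter> \<beta>) \<subseteq> Inv T X \<phi> (nu T X \<phi> \<alpha> \<inter> nu T X \<phi> \<beta>)"
    by (rule Inv_greatest[OF nu_invariant[OF downset_Int[OF \<alpha> \<beta>]]]) (auto simp: nu_def)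
  let ?S = "Inv T X \<phi> (nu T X \<phi> \<alpha> \<inter> nu T X \<phi> \<beta>)"
  show "?S \<subseteq> nu T X \<phi> (\<alpha> \<inter> \<beta>)"
  proof
    fix x assume "x \<in> ?S"
    then obtain \<gamma> where \<gamma>: "complete_orbit T X \<phi> x \<gamma>" "\<And>t. t \<in> T \<Longrightarrow> \<gamma> t \<in> ?S"
      using complete_orbit_in_invariant[OF invariant_Inv] by metis
    obtain M where M: "M \<in> MM" "alpha_limit T \<gamma> \<subseteq> M" using orbit_ends[OF \<gamma>(1)] by metis
    have "\<gamma> t \<in> nu T X \<phi> \<alpha> \<inter> nu T X \<phi> \<beta>" if "t \<in> T" for t
      by (rule subsetD[OF Inv_subset \<gamma>(2)[OF that]])
    then have "alpha_limit T \<gamma> \<subseteq> nu T X \<phi> \<alpha> \<inter> nu T X \<phi> \<beta>"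
      using closed_Int[OF nu_closed[OF \<alpha>] nu_closed[OF \<beta>]] by (rule alpha_limit_subset)
    then have "M \<inter> nu T X \<phi> \<alpha> \<noteq> {}" "M \<inter> nu T X \<phi> \<beta> \<noteq> {}"
      using M(2) alpha_limit_nonempty[OF \<gamma>(1)] by blast+
    then have "M \<in> \<alpha> \<inter> \<beta>" using morse_meets_nu[OF \<alpha> M(1)] morse_meets_nu[OF \<beta> M(1)] by blast
    then show "x \<in> nu T X \<phi> (\<alpha> \<inter> \<beta>)" using \<gamma>(1) M(2) by (rule in_nuI)
  qed
qed

lemma nu_MM: "nu T X \<phi> MM = Inv T X \<phi> X"
proof
  show "nu T X \<phi> MM \<subseteq> Inv T X \<phi> X"
    using nu_invariant[OF downset_MM] invariant_subset_space by (intro Inv_greatest)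
  show "Inv T X \<phi> X \<subseteq> nu T X \<phi> MM"
  proof
    fix x assume "x \<in> Inv T X \<phi> X"
    then obtain \<gamma> where \<gamma>: "complete_orbit T X \<phi> x \<gamma>"
      using complete_orbit_in_invariant[OF invariant_Inv] by metis
    obtain M where "M \<in> MM" "alpha_limit T \<gamma> \<subseteq> M" using orbit_ends[OF \<gamma>] by metis
    then show "x \<in> nu T X \<phi> MM" using \<gamma> in_nuI by metis
  qed
qed

lemma lattice_hom_nu: "lattice_hom (Downsets (MM, r)) (Invset T X \<phi>) (nu T X \<phi>)"
  unfolding lattice_hom_def downsets_eq
  by (auto simp: Downsets_def Invset_def nu_Un nu_empty nu_MM nu_Int nu_invariant)

abbreviation nu_lattice :: "'a set set"
  where "nu_lattice \<equiv> nu T X \<phi> ` Collect downset"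

lemma finite_nu_lattice: "finite nu_lattice"
proof -
  have "Collect downset \<subseteq> Pow MM" using downset_subset by blast
  then show ?thesis using finite_MM finite_subset by blast
qed

lemma sublattice_nu: "sublattice nu_lattice (Att T X \<phi>)"
proof -
  have top: "omega_limit T \<phi> X = nu T X \<phi> MM"
    unfolding nu_MM by (rule omega_limit_eq_Inv[OF closed_X subset_refl maps_to])
  have meet: "omega_limit T \<phi> (nu T X \<phi> \<alpha> \<inter> nu T X \<phi> \<beta>) = nu T X \<phi> (\<alpha> \<inter> \<beta>)"
    if \<alpha>: "downset \<alpha>" and \<beta>: "downset \<beta>" for \<alpha> \<beta>
    unfolding nu_Int[OF that]
  proof (rule omega_limit_eq_Inv[OF closed_Int[OF nu_closed[OF \<alpha>] nu_closed[OF \<beta>]]])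
    show "nu T X \<phi> \<alpha> \<inter> nu T X \<phi> \<beta> \<subseteq> X"
      using invariant_subset_space[OF nu_invariant[OF \<alpha>]] by blast
    show "\<phi> t x \<in> nu T X \<phi> \<alpha> \<inter> nu T X \<phi> \<beta>"
      if "t \<in> nonneg_times T" "x \<in> nu T X \<phi> \<alpha> \<inter> nu T X \<phi> \<beta>" for t x
      using that invariant_forward[OF nu_invariant[OF \<alpha>], of t x]
        invariant_forward[OF nu_invariant[OF \<beta>], of t x] by blast
  qed
  have "{} \<in> nu_lattice" "nu T X \<phi> MM \<in> nu_lattice"
    using nu_empty downset_empty downset_MM by (metis image_eqI mem_Collect_eq)+
  moreover have "A \<union> B \<in> nu_lattice \<and> omega_limit T \<phi> (A \<inter> B) \<in> nu_lattice"
    if AB: "A \<in> nu_lattice" "B \<in> nu_lattice" for A B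
  proof -
    obtain \<alpha> \<beta> where *: "downset \<alpha>" "downset \<beta>" "A = nu T X \<phi> \<alpha>" "B = nu T X \<phi> \<beta>"
      using AB by blast
    show ?thesis unfolding *(3,4) meet[OF *(1,2)] nu_Un[symmetric]
      using downset_Un[OF *(1,2)] downset_Int[OF *(1,2)] by blast
  qed
  ultimately show ?thesis
    unfolding sublattice_def Att_def using nu_attractor by (auto simp: top)
qed

section \<open>Join-irreducible elements and Morse sets of the image of \<open>\<nu>\<close>\<close>

definition below :: "'a set \<Rightarrow> 'a set set"
  where "below M = {N \<in> MM. (N, M) \<in> r}"

lemma downset_below: "downset (below M)"
  unfolding downset_def below_def using order_trans by blast

lemma downset_strictly_below: "downset (below M - {M})"
  unfolding downset_def below_def using order_trans order_antisym by blast

lemma self_below: "M \<in> MM \<Longrightarrow> M \<in> below M"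
  unfolding below_def using order_refl by simp

lemma below_subset: "downset \<alpha> \<Longrightarrow> M \<in> \<alpha> \<Longrightarrow> below M \<subseteq> \<alpha>"
  unfolding below_def using downsetD by blast

text \<open>Since \<open>\<nu>\<close> is an order embedding, this is a matter of down-sets: one
  properly contained in \<open>below M\<close> cannot contain \<open>M\<close>.\<close>

lemma nu_below_join_irreducible:
  assumes M: "M \<in> MM"
  shows "nu T X \<phi> (below M) \<in> join_irreducibles nu_lattice"
    and "the_pred nu_lattice (nu T X \<phi> (below M)) = nu T X \<phi> (below M - {M})"
proof -
  have mem: "nu T X \<phi> (below M) \<in> nu_lattice" "nu T X \<phi> (below M - {M}) \<in> nu_lattice"
    using downset_below downset_strictly_below by blast+
  have less: "nu T X \<phi> (below M - {M}) \<subset> nu T X \<phi> (below M)"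
    using nu_subset_iff[OF downset_strictly_below downset_below, of M M]
      nu_subset_iff[OF downset_below downset_strictly_below, of M M] self_below[OF M] by blast
  have largest: "A \<subseteq> nu T X \<phi> (below M - {M})"
    if A: "A \<in> nu_lattice" "A \<subset> nu T X \<phi> (below M)" for A
  proof -
    obtain \<alpha> where \<alpha>: "downset \<alpha>" "A = nu T X \<phi> \<alpha>" using A(1) by blast
    have "\<alpha> \<subseteq> below M" using A(2) nu_subset_iff[OF \<alpha>(1) downset_below] \<alpha>(2) by blast
    moreover have "M \<notin> \<alpha>"
      using A(2) nu_subset_iff[OF downset_below \<alpha>(1)] below_subset[OF \<alpha>(1)] \<alpha>(2) by blast
    ultimately have "\<alpha> \<subseteq> below M - {M}" by blast
    then show ?thesis using nu_subset_iff[OF \<alpha>(1) downset_strictly_below] \<alpha>(2) by blast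
  qed
  show "nu T X \<phi> (below M) \<in> join_irreducibles nu_lattice"
    and "the_pred nu_lattice (nu T X \<phi> (below M)) = nu T X \<phi> (below M - {M})"
    using join_irreducibleI[OF mem less largest] by auto
qed

text \<open>Take \<open>M\<close> in the down-set of \<open>A\<close> but not in that of its
  predecessor. Then \<open>\<nu>(below M)\<close> is contained in \<open>A\<close> and not in the
  predecessor, so it equals \<open>A\<close>.\<close>

lemma join_irreducibles_nu: "join_irreducibles nu_lattice = (\<lambda>M. nu T X \<phi> (below M)) ` MM"
proof
  show "(\<lambda>M. nu T X \<phi> (below M)) ` MM \<subseteq> join_irreducibles nu_lattice"
    using nu_below_join_irreducible(1) by blast
  show "join_irreducibles nu_lattice \<subseteq> (\<lambda>M. nu T X \<phi> (below M)) ` MM"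
  proof
    fix A assume A: "A \<in> join_irreducibles nu_lattice"
    then have "A \<in> nu_lattice" by (simp add: join_irreducibles_def)
    then obtain \<alpha> where \<alpha>: "downset \<alpha>" "A = nu T X \<phi> \<alpha>" by blast
    note pred = join_irreducible_pred[OF finite_nu_lattice A]
    obtain \<beta> where \<beta>: "downset \<beta>" "the_pred nu_lattice A = nu T X \<phi> \<beta>" using pred(1) by blast
    have "\<not> \<alpha> \<subseteq> \<beta>" using pred(2) nu_subset_iff[OF \<alpha>(1) \<beta>(1)] \<alpha>(2) \<beta>(2) by blast
    then obtain M where M: "M \<in> \<alpha>" "M \<notin> \<beta>" by blast
    then have MM: "M \<in> MM" using downset_subset[OF \<alpha>(1)] by blast
    have "\<not> below M \<subseteq> \<beta>" using self_below[OF MM] M(2) by blast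
    then have "\<not> nu T X \<phi> (below M) \<subseteq> the_pred nu_lattice A"
      using nu_subset_iff[OF downset_below \<beta>(1)] \<beta>(2) by simp
    moreover have "nu T X \<phi> (below M) \<in> nu_lattice" using downset_below by blast
    moreover have "nu T X \<phi> (below M) \<subseteq> A"
      using nu_subset_iff[OF downset_below \<alpha>(1)] below_subset[OF \<alpha>(1) M(1)] \<alpha>(2) by simp
    ultimately have "A = nu T X \<phi> (below M)" using pred(3) by blast
    then show "A \<in> (\<lambda>M. nu T X \<phi> (below M)) ` MM" using MM by blast
  qed
qed

text \<open>For \<open>x\<close> on the left, \<open>\<omega>(x)\<close> lies in a Morse set that is
  below \<open>M\<close> but not strictly, thus in \<open>M\<close>. Were \<open>x\<close> outside
  all Morse sets, each of its orbits would come from strictly above \<open>M\<close>, whereas a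
  point of \<open>\<nu>(below M)\<close> has one from a set in \<open>below M\<close>.\<close>

lemma morse_set_nu_below:
  assumes M: "M \<in> MM"
  shows "morse_set T X \<phi> nu_lattice (nu T X \<phi> (below M)) = M"
proof -
  let ?B = "nu T X \<phi> (below M - {M})"
  have "M \<subseteq> nu T X \<phi> (below M) \<inter> dual_repeller T X \<phi> ?B"
  proof
    fix x assume x: "x \<in> M"
    have xX: "x \<in> X" using x invariant_subset_space[OF morse_invariant[OF M]] by blast
    have "M \<inter> ?B = {}" using morse_meets_nu[OF downset_strictly_below M] by blast
    then have "omega_limit T \<phi> {x} \<inter> ?B = {}" using omega_limit_morse[OF M x] by blast
    then show "x \<in> nu T X \<phi> (below M) \<inter> dual_repeller T X \<phi> ?B"
      using morse_subset_nu[OF self_below[OF M] M] x xX unfolding dual_repeller_def by blast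
  qed
  moreover have "nu T X \<phi> (below M) \<inter> dual_repeller T X \<phi> ?B \<subseteq> M"
  proof
    fix x assume "x \<in> nu T X \<phi> (below M) \<inter> dual_repeller T X \<phi> ?B"
    then have x: "x \<in> nu T X \<phi> (below M)" and xX: "x \<in> X" and disj: "omega_limit T \<phi> {x} \<inter> ?B = {}"
      unfolding dual_repeller_def by auto
    obtain N where N: "N \<in> MM" "omega_limit T \<phi> {x} \<subseteq> N" using omega_in[OF xX] by blast
    note ne = omega_limit_nonempty[OF xX]
    have "omega_limit T \<phi> {x} \<subseteq> nu T X \<phi> (below M)"
      by (rule omega_limit_point_subset[OF nu_closed[OF downset_below] nu_invariant[OF downset_below] x])
    then have "N \<in> below M" using morse_meets_nu[OF downset_below N(1)] N(2) ne by blast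
    moreover have "N \<notin> below M - {M}"
    proof
      assume "N \<in> below M - {M}"
      then have "N \<subseteq> ?B" by (rule morse_subset_nu[OF _ N(1)])
      then show False using N(2) ne disj by blast
    qed
    ultimately have NM: "N = M" by blast
    obtain P \<gamma> where P: "P \<in> below M" "P \<in> MM" "complete_orbit T X \<phi> x \<gamma>" "alpha_limit T \<gamma> \<subseteq> P"
      using in_nuE[OF downset_below x] .
    have "x \<in> \<Union>MM"
    proof (rule ccontr)
      assume "x \<notin> \<Union>MM"
      then have "N \<noteq> P" using orbit_order_strict[OF P(3) N(1) P(2) _ N(2) P(4)] by simp
      moreover have "(N, P) \<in> r" by (rule orbit_order[OF P(3) N(1) P(2) N(2) P(4)])
      ultimately show False using P(1) order_antisym unfolding NM below_def by blast
    qed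
    then obtain Q where Q: "Q \<in> MM" "x \<in> Q" by blast
    have "N = Q" by (rule morse_unique_subset[OF N(1) Q(1) N(2) omega_limit_morse[OF Q] ne])
    then show "x \<in> M" using Q(2) NM by simp
  qed
  ultimately show ?thesis
    unfolding morse_set_def nu_below_join_irreducible(2)[OF M] by (rule subset_antisym[rotated])
qed

theorem morse_rep_nu: "morse_rep T X \<phi> nu_lattice = (MM, r)"
proof -
  have le_iff: "nu T X \<phi> (below M) \<subseteq> nu T X \<phi> (below N) \<longleftrightarrow> (M, N) \<in> r" if "M \<in> MM" "N \<in> MM" for M N
    unfolding nu_subset_iff[OF downset_below downset_below]
    using self_below[OF that(1)] below_subset[OF downset_below, of M N] that(1)
    unfolding below_def by blast
  have "morse_set T X \<phi> nu_lattice ` join_irreducibles nu_lattice = MM"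
    unfolding join_irreducibles_nu image_image using morse_set_nu_below by simp
  moreover have "{(morse_set T X \<phi> nu_lattice A, morse_set T X \<phi> nu_lattice A') |A A'.
      A \<in> join_irreducibles nu_lattice \<and> A' \<in> join_irreducibles nu_lattice \<and> A \<subseteq> A'} = r" (is "?R = r")
  proof -
    have "?R = {(M, N) |M N. M \<in> MM \<and> N \<in> MM \<and> (M, N) \<in> r}"
    proof (intro equalityI subsetI)
      fix p assume "p \<in> ?R"
      then obtain A A' where A: "A \<in> join_irreducibles nu_lattice" "A' \<in> join_irreducibles nu_lattice" "A \<subseteq> A'"
          "p = (morse_set T X \<phi> nu_lattice A, morse_set T X \<phi> nu_lattice A')" by blast
      obtain M N where MN: "M \<in> MM" "N \<in> MM" "A = nu T X \<phi> (below M)" "A' = nu T X \<phi> (below N)"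
        using A(1,2) unfolding join_irreducibles_nu by blast
      show "p \<in> {(M, N) |M N. M \<in> MM \<and> N \<in> MM \<and> (M, N) \<in> r}"
        using A(3) MN(1,2) le_iff[OF MN(1,2)]
        by (simp add: A(4) MN(3,4) morse_set_nu_below[OF MN(1)] morse_set_nu_below[OF MN(2)])
    next
      fix p assume "p \<in> {(M, N) |M N. M \<in> MM \<and> N \<in> MM \<and> (M, N) \<in> r}"
      then obtain M N where MN: "M \<in> MM" "N \<in> MM" "(M, N) \<in> r" "p = (M, N)" by blast
      have "p = (morse_set T X \<phi> nu_lattice (nu T X \<phi> (below M)),
          morse_set T X \<phi> nu_lattice (nu T X \<phi> (below N)))"
        unfolding MN(4) morse_set_nu_below[OF MN(1)] morse_set_nu_below[OF MN(2)] ..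
      then show "p \<in> ?R"
        using nu_below_join_irreducible(1)[OF MN(1)] nu_below_join_irreducible(1)[OF MN(2)]
          le_iff[OF MN(1,2)] MN(3) by blast
    qed
    then show ?thesis using order_carrier by auto
  qed
  ultimately show ?thesis unfolding morse_rep_def by simp
qed

lemma morse_rep_subordinate_nu: "morse_rep_subordinate_to T X \<phi> (MM, r) nu_lattice"
  unfolding morse_rep_subordinate_to_def morse_rep_nu
  using finite_nu_lattice sublattice_nu by simp

end

section \<open>The equivalence and the uniqueness of the lattice\<close>

theorem theorem8p5:
  fixes T :: "real set" and X :: "'a::metric_space set" and \<phi> :: "real \<Rightarrow> 'a \<Rightarrow> 'a"
    and MM :: "'a set set" and r :: "'a set rel"
  assumes "compact_dynamical_system T X \<phi>"
    and "finite_poset (MM, r)"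
    and "\<And>M. M \<in> MM \<Longrightarrow> M \<noteq> {} \<and> compact M \<and> invariant T X \<phi> M"
    and "pairwise disjnt MM"
  shows
    "((\<exists>\<A>. morse_rep_subordinate_to T X \<phi> (MM, r) \<A>) \<longleftrightarrow>
       (\<forall>x\<in>X. \<exists>M\<in>MM. omega_limit T \<phi> {x} \<subseteq> M) \<and>
       (\<forall>x \<gamma>. complete_orbit T X \<phi> x \<gamma> \<and> x \<notin> \<Union>MM \<longrightarrow>
          (\<exists>M\<in>MM. \<exists>M'\<in>MM. (M, M') \<in> r \<and> M \<noteq> M' \<and>
             omega_limit T \<phi> {x} \<subseteq> M \<and> alpha_limit T \<gamma> \<subseteq> M'))) \<and>
     (\<forall>\<A>. morse_rep_subordinate_to T X \<phi> (MM, r) \<A> \<longrightarrow>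
       lattice_hom (Downsets (MM, r)) (Invset T X \<phi>) (nu T X \<phi>) \<and>
       inj_on (nu T X \<phi>) (elems (Downsets (MM, r))) \<and>
       (\<forall>\<alpha>\<in>elems (Downsets (MM, r)). nu T X \<phi> \<alpha> \<in> elems (Att T X \<phi>)) \<and>
       \<A> = nu T X \<phi> ` elems (Downsets (MM, r)) \<and>
       (MM, r) = morse_rep T X \<phi> (nu T X \<phi> ` elems (Downsets (MM, r))))"
    (is "((\<exists>\<A>. ?sub \<A>) \<longleftrightarrow> ?omega \<and> ?connect) \<and> ?uniqueness")
proof -
  interpret compact_dynamical_system T X \<phi> by fact
  have decomposition: "morse_decomposition T X \<phi> MM r" if ?omega ?connect
  proof (unfold_locales, goal_cases)
    case (5 x)
    then show ?case using that(1) by blast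
  next
    case (6 x \<gamma>)
    then show ?case by (rule that(2)[rule_format, OF conjI])
  qed (use assms in \<open>auto simp: finite_poset_def\<close>)
  \<comment> \<open>The image equation is included here for an arbitrary \<open>\<A>\<close>; it is
    what identifies the lattice uniquely.\<close>
  have forward: "?omega \<and> ?connect \<and> \<A> = nu T X \<phi> ` elems (Downsets (MM, r))" if sub: "?sub \<A>" for \<A>
  proof -
    interpret finite_attractor_lattice T X \<phi> \<A>
      by unfold_locales (use sub in \<open>auto simp: morse_rep_subordinate_to_def\<close>)
    have rep: "(MM, r) = morse_rep T X \<phi> \<A>" using sub by (simp add: morse_rep_subordinate_to_def)
    then have MM: "MM = morse_set T X \<phi> \<A> ` join_irreducibles \<A>"
      and r: "r = {(morse_set T X \<phi> \<A> A, morse_set T X \<phi> \<A> A') |A A'.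
        A \<in> join_irreducibles \<A> \<and> A' \<in> join_irreducibles \<A> \<and> A \<subseteq> A'}"
      unfolding morse_rep_def by auto
    have omega: ?omega
    proof
      fix x assume "x \<in> X"
      then obtain C where "C \<in> join_irreducibles \<A>" "omega_limit T \<phi> {x} \<subseteq> morse_set T X \<phi> \<A> C"
        using omega_in_morse_set by metis
      then show "\<exists>M\<in>MM. omega_limit T \<phi> {x} \<subseteq> M" unfolding MM by blast
    qed
    have connect: ?connect
    proof (intro allI impI, elim conjE)
      fix x \<gamma> assume \<gamma>: "complete_orbit T X \<phi> x \<gamma>" "x \<notin> \<Union>MM"
      obtain C C' where C: "C \<in> join_irreducibles \<A>" "C' \<in> join_irreducibles \<A>" "C \<subseteq> C'"
        "morse_set T X \<phi> \<A> C \<noteq> morse_set T X \<phi> \<A> C'"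
        "omega_limit T \<phi> {x} \<subseteq> morse_set T X \<phi> \<A> C" "alpha_limit T \<gamma> \<subseteq> morse_set T X \<phi> \<A> C'"
        using connecting_orbit[OF \<gamma>(1)] \<gamma>(2) unfolding MM .
      have "(morse_set T X \<phi> \<A> C, morse_set T X \<phi> \<A> C') \<in> r" unfolding r using C(1-3) by blast
      then show "\<exists>M\<in>MM. \<exists>M'\<in>MM. (M, M') \<in> r \<and> M \<noteq> M' \<and>
          omega_limit T \<phi> {x} \<subseteq> M \<and> alpha_limit T \<gamma> \<subseteq> M'"
        using C unfolding MM by blast
    qed
    have "morse_set T X \<phi> \<A> C \<noteq> {}" if "C \<in> join_irreducibles \<A>" for C
      using assms(3)[of "morse_set T X \<phi> \<A> C"] that unfolding MM by blast
    from attractors_eq_nu_image[OF this] omega connect show ?thesis unfolding rep by blast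
  qed
  have backward: "?sub (nu T X \<phi> ` elems (Downsets (MM, r)))" if "?omega" "?connect"
  proof -
    interpret morse_decomposition T X \<phi> MM r using decomposition[OF that] .
    show ?thesis unfolding downsets_eq by (rule morse_rep_subordinate_nu)
  qed
  have uniqueness: ?uniqueness
  proof (intro allI impI)
    fix \<A> assume "?sub \<A>"
    \<comment> \<open>A given lattice yields the two conditions, hence a Morse decomposition, whose
      facts about the image of \<open>\<nu>\<close> then apply to that lattice.\<close>
    from forward[OF this] have cond: ?omega ?connect
      and \<A>: "\<A> = nu T X \<phi> ` elems (Downsets (MM, r))" by blast+
    interpret morse_decomposition T X \<phi> MM r using decomposition[OF cond] .
    have "\<forall>\<alpha>\<in>elems (Downsets (MM, r)). nu T X \<phi> \<alpha> \<in> elems (Att T X \<phi>)"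
      unfolding downsets_eq using nu_attractor by (simp add: Att_def)
    with \<A> lattice_hom_nu nu_inj morse_rep_nu
    show "lattice_hom (Downsets (MM, r)) (Invset T X \<phi>) (nu T X \<phi>) \<and>
       inj_on (nu T X \<phi>) (elems (Downsets (MM, r))) \<and>
       (\<forall>\<alpha>\<in>elems (Downsets (MM, r)). nu T X \<phi> \<alpha> \<in> elems (Att T X \<phi>)) \<and>
       \<A> = nu T X \<phi> ` elems (Downsets (MM, r)) \<and>
       (MM, r) = morse_rep T X \<phi> (nu T X \<phi> ` elems (Downsets (MM, r)))"
      unfolding downsets_eq by simp
  qed
  have "(\<exists>\<A>. ?sub \<A>) \<longleftrightarrow> ?omega \<and> ?connect"
  proof
    assume "\<exists>\<A>. ?sub \<A>"
    then obtain \<A> where "?sub \<A>" ..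
    from forward[OF this] show "?omega \<and> ?connect" by (elim conjE) (rule conjI)
  next
    assume "?omega \<and> ?connect"
    then show "\<exists>\<A>. ?sub \<A>" by (elim conjE) (rule exI, rule backward)
  qed
  then show ?thesis using uniqueness by (rule conjI)
qed

end
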